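(* Let $\phi:\mathcal H\to\mathbb R\cup\{+\infty\}$ be a proper lower semicontinuous convex function with $\operatorname{argmin}\phi\neq\emptyset$, and let $\alpha\ge3$, $\beta>0$, $t_0>0$. Let $(x,y):[t_0,+\infty[\to\mathcal H\times\mathcal H$ be the global strong solution of the system $$\left\{\begin{array}{rcl}\dot x(t)+\beta\partial\phi(x(t))-\left(\frac1\beta-\frac{\alpha}{t}\right)x(t)+\frac1\beta y(t)&\ni&0\\[2mm] \dot y(t)-\left(\frac1\beta-\frac{\alpha}{t}+\frac{\alpha\beta}{t^2}\right)x(t)+\frac1\beta y(t)&=&0\end{array}\right.$$ with initial value $(x(t_0),y(t_0))=(x_0,y_0)\in\operatorname{dom}\phi\times\mathcal H$. Let $x^*\in\operatorname{argmin}\phi$, $\lambda\in[2,\alpha-1]$ and $t_1=\max\{t_0,\beta\}$. With $\xi$ and $\mathcal E_\lambda$ as in the context: (1) $\lim_{t\to+\infty}\mathcal E_\lambda(t)$ exists. (2) For $t\ge s>t_1$, $\phi(x(t))-\min\phi\le\frac1{t^2}\left(\frac{s}{s-\beta}\right)^{\alpha-2}\mathcal E_\lambda(s)$; in particular $\phi(x(t))-\min\phi=\mathcal O(t^{-2})$ as $t\to+\infty$. (3) $x$ is bounded. (4) $\int_{t_0}^\infty t^2\|\xi(t)\|^2dt<+\infty$ and $\int_{t_0}^\infty\|\xi(t)\|dt<+\infty$. (5) $\|\dot x(t)+\beta\xi(t)\|=\mathcal O(t^{-1})$ as $t\to+\infty$ (for almost every $t$).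
   Context: $\mathcal H$ is a real Hilbert space with norm $\|\cdot\|$; $\partial\phi$ is the convex subdifferential; $\operatorname{dom}\phi=\{x:\phi(x)<+\infty\}$ and $\operatorname{dom}(\partial\phi)=\{x:\partial\phi(x)\neq\emptyset\}$. Strong solution: $(x,y)$ is a global strong solution of the system if for every $T>t_0$ it is continuous on $[t_0,T]$, absolutely continuous on every compact subset of $]t_0,T]$, $x(t)\in\operatorname{dom}(\partial\phi)$ for almost every $t\in]t_0,T]$, and both relations of the system hold for almost every $t\in]t_0,T]$. For every initial datum in $\operatorname{dom}\phi\times\mathcal H$ there is a unique such solution; for it $x$ is absolutely continuous on $[t_0,T]$ with $\dot x\in L^2(t_0,T;\mathcal H)$ for all $T>t_0$, and there is a function $\xi:[t_0,+\infty[\to\mathcal H$ with $\xi(t)\in\partial\phi(x(t))$ for all $t>t_0$, $\dot x(t)+\beta\xi(t)-\left(\frac1\beta-\frac{\alpha}{t}\right)x(t)+\frac1\beta y(t)=0$ for almost every $t>t_0$, and $\xi\in L^2(t_0,T;\mathcal H)$ for all $T>t_0$ ($\xi$ is determined almost everywhere). Set $\dot u(t)=\left(\frac1\beta-\frac{\alpha}{t}\right)x(t)-\frac1\beta y(t)$ for $t\ge t_0$ (so $\dot u=\dot x+\beta\xi$ almost everywhere), and $$\mathcal E_\lambda(t)=t\big(t-\beta(\lambda+2-\alpha)\big)\big(\phi(x(t))-\min\phi\big)+\frac12\|\lambda(x(t)-x^* )+t\dot u(t)\|^2+\lambda(\alpha-\lambda-1)\frac12\|x(t)-x^*\|^2 .$$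 *)

theory Defs
  imports "HOL-Analysis.Analysis" "HOL-Library.Landau_Symbols"
begin

text \<open>
  Functions with values in the reals extended by \<open>+\<infinity>\<close> are rendered as \<open>ereal\<close>-valued functions;
  the value \<open>-\<infinity>\<close> is excluded by properness.
\<close>

definition effective_domain :: "('a \<Rightarrow> ereal) \<Rightarrow> 'a set" where
  "effective_domain \<phi> = {x. \<phi> x < \<infinity>}"

definition proper_function :: "('a \<Rightarrow> ereal) \<Rightarrow> bool" where
  "proper_function \<phi> \<longleftrightarrow> (\<forall>x. \<phi> x \<noteq> -\<infinity>) \<and> effective_domain \<phi> \<noteq> {}"

definition lower_semicontinuous :: "('a::topological_space \<Rightarrow> ereal) \<Rightarrow> bool" where
  "lower_semicontinuous \<phi> \<longleftrightarrow> (\<forall>x. \<phi> x \<le> Liminf (at x) \<phi>)"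

text \<open>Note that \<open>0 * \<infinity> = 0\<close> in \<open>ereal\<close>, so the cases \<open>u = 0\<close> and \<open>v = 0\<close> are trivial.\<close>

definition convex_function :: "('a::real_vector \<Rightarrow> ereal) \<Rightarrow> bool" where
  "convex_function \<phi> \<longleftrightarrow>
     (\<forall>x y. \<forall>u\<ge>0. \<forall>v\<ge>0. u + v = 1 \<longrightarrow>
        \<phi> (u *\<^sub>R x + v *\<^sub>R y) \<le> ereal u * \<phi> x + ereal v * \<phi> y)"

definition argmin_set :: "('a \<Rightarrow> ereal) \<Rightarrow> 'a set" where
  "argmin_set \<phi> = {x. \<forall>z. \<phi> x \<le> \<phi> z}"

text \<open>This is the minimum of \<open>\<phi>\<close> as soon as \<open>argmin_set \<phi>\<close> is nonempty.\<close>

definition min_value :: "('a \<Rightarrow> ereal) \<Rightarrow> ereal" where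
  "min_value \<phi> = (INF z. \<phi> z)"

text \<open>For proper \<open>\<phi>\<close> the subdifferential is empty at every point where \<open>\<phi>\<close> is \<open>+\<infinity>\<close>.\<close>

definition subdifferential :: "('a::real_inner \<Rightarrow> ereal) \<Rightarrow> 'a \<Rightarrow> 'a set" where
  "subdifferential \<phi> x = {g. \<forall>z. \<phi> x + ereal (g \<bullet> (z - x)) \<le> \<phi> z}"

definition subdifferential_domain :: "('a::real_inner \<Rightarrow> ereal) \<Rightarrow> 'a set" where
  "subdifferential_domain \<phi> = {x. subdifferential \<phi> x \<noteq> {}}"

text \<open>
  Absolute continuity in the \<open>\<epsilon>\<close>-\<open>\<delta>\<close> sense; on a set that is not an interval, the end points of the
  nonoverlapping intervals are required to lie in the set.
\<close>

definition abs_continuous_on :: "real set \<Rightarrow> (real \<Rightarrow> 'a::real_normed_vector) \<Rightarrow> bool" where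
  "abs_continuous_on S f \<longleftrightarrow>
     (\<forall>\<epsilon>>0. \<exists>\<delta>>0. \<forall>(n::nat) a b.
        (\<forall>i<n. a i \<in> S \<and> b i \<in> S \<and> a i \<le> b i) \<and>
        disjoint_family_on (\<lambda>i. {a i<..<b i}) {..<n} \<and>
        (\<Sum>i<n. b i - a i) < \<delta> \<longrightarrow>
        (\<Sum>i<n. norm (f (b i) - f (a i))) < \<epsilon>)"

text \<open>
  Membership in \<open>L\<^sup>2(a,b;H)\<close>. The predicate \<open>measurable_on\<close> (almost everywhere limit of continuous
  functions) is strong measurability, as appropriate for a Hilbert space that need not be separable.
\<close>

definition L2_on :: "real \<Rightarrow> real \<Rightarrow> (real \<Rightarrow> 'a::real_normed_vector) \<Rightarrow> bool" where
  "L2_on a b f \<longleftrightarrow>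
     f measurable_on {a<..<b} \<and> set_integrable lebesgue {a<..<b} (\<lambda>t. (norm (f t))\<^sup>2)"

text \<open>
  Only the values of \<open>x\<close> and \<open>y\<close> on \<open>[t0, +\<infinity>)\<close> matter. The clauses on the system include the
  existence of the derivatives \<open>x'\<close> and \<open>y'\<close> almost everywhere.
\<close>

definition global_strong_solution ::
  "('a::real_inner \<Rightarrow> ereal) \<Rightarrow> real \<Rightarrow> real \<Rightarrow> real \<Rightarrow> (real \<Rightarrow> 'a) \<Rightarrow> (real \<Rightarrow> 'a) \<Rightarrow> bool" where
  "global_strong_solution \<phi> \<alpha> \<beta> t0 x y \<longleftrightarrow>
     (\<forall>T>t0.
        continuous_on {t0..T} x \<and> continuous_on {t0..T} y \<and>
        (\<forall>K. compact K \<and> K \<subseteq> {t0<..T} \<longrightarrow> abs_continuous_on K x \<and> abs_continuous_on K y) \<and>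
        (AE t in lebesgue. t \<in> {t0<..T} \<longrightarrow> x t \<in> subdifferential_domain \<phi>) \<and>
        (AE t in lebesgue. t \<in> {t0<..T} \<longrightarrow>
           (\<exists>x'. (x has_vector_derivative x') (at t) \<and>
              (\<exists>g\<in>subdifferential \<phi> (x t).
                 x' + \<beta> *\<^sub>R g - (1 / \<beta> - \<alpha> / t) *\<^sub>R x t + (1 / \<beta>) *\<^sub>R y t = 0))) \<and>
        (AE t in lebesgue. t \<in> {t0<..T} \<longrightarrow>
           (\<exists>y'. (y has_vector_derivative y') (at t) \<and>
              y' - (1 / \<beta> - \<alpha> / t + \<alpha> * \<beta> / t\<^sup>2) *\<^sub>R x t + (1 / \<beta>) *\<^sub>R y t = 0)))"

definition u_dot :: "real \<Rightarrow> real \<Rightarrow> (real \<Rightarrow> 'a) \<Rightarrow> (real \<Rightarrow> 'a) \<Rightarrow> real \<Rightarrow> 'a::real_vector" where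
  "u_dot \<alpha> \<beta> x y t = (1 / \<beta> - \<alpha> / t) *\<^sub>R x t - (1 / \<beta>) *\<^sub>R y t"

text \<open>
  The coercion \<open>real_of_ereal\<close> sends \<open>\<infinity>\<close> to \<open>0\<close>; the energy is meaningful only where \<open>\<phi> (x t)\<close> is
  finite, which is the case wherever \<open>x t\<close> has a subgradient or lies in the effective domain.
\<close>

definition energy ::
  "('a::real_inner \<Rightarrow> ereal) \<Rightarrow> real \<Rightarrow> real \<Rightarrow> real \<Rightarrow> 'a \<Rightarrow> (real \<Rightarrow> 'a) \<Rightarrow> (real \<Rightarrow> 'a) \<Rightarrow> real \<Rightarrow> real"
where
  "energy \<phi> \<alpha> \<beta> l xs x y t =
     t * (t - \<beta> * (l + 2 - \<alpha>)) * real_of_ereal (\<phi> (x t) - min_value \<phi>)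
     + 1 / 2 * (norm (l *\<^sub>R (x t - xs) + t *\<^sub>R u_dot \<alpha> \<beta> x y t))\<^sup>2
     + l * (\<alpha> - l - 1) * (1 / 2) * (norm (x t - xs))\<^sup>2"

end

theory Submission
  imports Defs
begin

text \<open>
  Put \<open>w t = \<phi> (x t) - min \<phi>\<close> and \<open>v = x' + \<beta> \<xi>\<close>. The second equation of the system
  turns into \<open>v' = - (\<alpha> / t) x' - \<xi>\<close>. A partition argument applied to the
  subgradient inequality shows that \<open>w\<close> is locally absolutely continuous. Since the linear
  minorant of \<open>w\<close> given by \<open>\<xi> t\<close> touches \<open>w\<close> at \<open>t\<close>, the one-sided chain rule
  \<open>w' \<le> \<xi> \<bullet> x'\<close> is enough, and it yields
  \<open>E' \<le> ((\<alpha> - 2) \<beta> / (t (t - \<beta>))) E - \<beta> t (t - \<beta>) \<bar>\<xi>\<bar>\<^sup>2\<close>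
  for the energy \<open>E\<close>. Hence \<open>G = (t / (t - \<beta>)) powr (\<alpha> - 2) * E\<close> is nonnegative and
  nonincreasing, and its total decrease bounds the integral of \<open>t\<^sup>2 \<bar>\<xi>\<bar>\<^sup>2\<close>.
\<close>

subsection \<open>Absolutely continuous functions\<close>

text \<open>The range of \<open>l\<close> comes from the derivative of the energy. The derivative of
  the weight, combined with \<open>l * (t - \<beta>)\<close> times the subgradient inequality at the
  minimizer, leaves \<open>((2 - l) * t + (\<alpha> - 2) * \<beta>) * w t\<close>, so
  \<open>l \<ge> 2\<close> removes the growing part. The velocity enters with the coefficient
  \<open>- t * (\<alpha> - l - 1)\<close>, whence \<open>l \<le> \<alpha> - 1\<close>. The remainder
  \<open>(\<alpha> - 2) * \<beta> * w t\<close> is of lower order than the energy, which contains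
  \<open>w t\<close> with a weight of at least \<open>t * (t - \<beta>)\<close>; dividing by that
  weight produces the rate that the factor in \<open>G\<close> compensates. For
  \<open>\<alpha> \<ge> 3\<close> the value \<open>l = 2\<close> is always admissible. Boundedness
  of \<open>x\<close>, integrability of \<open>\<xi>\<close> and the decay of \<open>v\<close> are
  all drawn from it, whatever \<open>l\<close> is given. Every estimate starts strictly to the right
  of \<open>t0\<close>, because absolute continuity and the subgradients are available only
  there.\<close>

lemma abs_continuous_onE:
  assumes "abs_continuous_on S f" and "0 < e"
  obtains d where "0 < d"
    and "\<And>(n::nat) a b. \<lbrakk>\<forall>i<n. a i \<in> S \<and> b i \<in> S \<and> a i \<le> b i;
        disjoint_family_on (\<lambda>i. {a i<..<b i}) {..<n}; (\<Sum>i<n. b i - a i) < d\<rbrakk>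
        \<Longrightarrow> (\<Sum>i<n. norm (f (b i) - f (a i))) < e"
proof -
  from assms(1)[unfolded abs_continuous_on_def, rule_format, OF assms(2)] obtain d where "0 < d"
    "\<forall>(n::nat) a b. (\<forall>i<n. a i \<in> S \<and> b i \<in> S \<and> a i \<le> b i) \<and>
        disjoint_family_on (\<lambda>i. {a i<..<b i}) {..<n} \<and> (\<Sum>i<n. b i - a i) < d \<longrightarrow>
        (\<Sum>i<n. norm (f (b i) - f (a i))) < e"
    by auto
  then show ?thesis by (intro that[of d]) auto
qed

lemma abs_continuous_on_imp_continuous_on:
  assumes "abs_continuous_on S f"
  shows "continuous_on S f"
proof (unfold continuous_on_iff, intro ballI allI impI)
  fix t and e :: real assume t: "t \<in> S" and "e > 0"
  obtain d where "d > 0" and d: "\<And>(n::nat) a b. \<lbrakk>\<forall>i<n. a i \<in> S \<and> b i \<in> S \<and> a i \<le> b i;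
        disjoint_family_on (\<lambda>i. {a i<..<b i}) {..<n}; (\<Sum>i<n. b i - a i) < d\<rbrakk>
        \<Longrightarrow> (\<Sum>i<n. norm (f (b i) - f (a i))) < e"
    using abs_continuous_onE[OF assms(1) \<open>e > 0\<close>] by blast
  have "dist (f s) (f t) < e" if "s \<in> S" "dist s t < d" for s
    using d[of 1 "\<lambda>_. min s t" "\<lambda>_. max s t"] that t
    by (cases "s \<le> t") (auto simp: disjoint_family_on_def dist_norm norm_minus_commute)
  then show "\<exists>d>0. \<forall>s\<in>S. dist s t < d \<longrightarrow> dist (f s) (f t) < e"
    using \<open>d > 0\<close> by blast
qed

text \<open>The closure properties (sums, products, norms) are instances of this comparison. Two
  dominating functions are allowed because sums and products involve the increments of both
  operands.\<close>

lemma abs_continuous_on_dominated: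
  assumes g: "abs_continuous_on S g" and h: "abs_continuous_on S h" and "0 \<le> C"
    and le: "\<And>s t. s \<in> S \<Longrightarrow> t \<in> S \<Longrightarrow> s \<le> t \<Longrightarrow>
               norm (f t - f s) \<le> C * (norm (g t - g s) + norm (h t - h s))"
  shows "abs_continuous_on S f"
  unfolding abs_continuous_on_def
proof (intro allI impI)
  fix e :: real assume "e > 0"
  \<comment> \<open>The summand 1 admits \<open>C = 0\<close> and makes the final estimate strict,
    as \<open>C / (C + 1) < 1\<close>.\<close>
  define e' where "e' = e / (2 * (C + 1))"
  have e': "e' > 0" using \<open>e > 0\<close> \<open>0 \<le> C\<close> by (simp add: e'_def)
  obtain d1 where "d1 > 0" and d1: "\<And>(n::nat) a b. \<lbrakk>\<forall>i<n. a i \<in> S \<and> b i \<in> S \<and> a i \<le> b i;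
        disjoint_family_on (\<lambda>i. {a i<..<b i}) {..<n}; (\<Sum>i<n. b i - a i) < d1\<rbrakk>
        \<Longrightarrow> (\<Sum>i<n. norm (g (b i) - g (a i))) < e'"
    using abs_continuous_onE[OF g e'] by blast
  obtain d2 where "d2 > 0" and d2: "\<And>(n::nat) a b. \<lbrakk>\<forall>i<n. a i \<in> S \<and> b i \<in> S \<and> a i \<le> b i;
        disjoint_family_on (\<lambda>i. {a i<..<b i}) {..<n}; (\<Sum>i<n. b i - a i) < d2\<rbrakk>
        \<Longrightarrow> (\<Sum>i<n. norm (h (b i) - h (a i))) < e'"
    using abs_continuous_onE[OF h e'] by blast
  have "(\<Sum>i<n. norm (f (b i) - f (a i))) < e"
    if ab: "\<forall>i<n. a i \<in> S \<and> b i \<in> S \<and> a i \<le> b i"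
      and "disjoint_family_on (\<lambda>i. {a i<..<b i}) {..<n}"
      and "(\<Sum>i<n. b i - a i) < min d1 d2" for n :: nat and a b
  proof -
    have "(\<Sum>i<n. norm (f (b i) - f (a i)))
        \<le> (\<Sum>i<n. C * (norm (g (b i) - g (a i)) + norm (h (b i) - h (a i))))"
      using ab by (intro sum_mono le) auto
    also have "\<dots> = C * ((\<Sum>i<n. norm (g (b i) - g (a i))) + (\<Sum>i<n. norm (h (b i) - h (a i))))"
      by (simp add: sum_distrib_left sum.distrib distrib_left)
    also have "\<dots> \<le> C * (e' + e')"
      using d1[of n a b] d2[of n a b] that less_imp_le \<open>0 \<le> C\<close> by (intro mult_left_mono add_mono) auto
    also have "e' + e' = e / (C + 1)"
      using \<open>0 \<le> C\<close> by (simp add: e'_def divide_simps)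
    also have "C * (e / (C + 1)) < e"
      using \<open>e > 0\<close> \<open>0 \<le> C\<close> by (simp add: divide_simps)
    finally show ?thesis .
  qed
  then show "\<exists>d>0. \<forall>(n::nat) a b. (\<forall>i<n. a i \<in> S \<and> b i \<in> S \<and> a i \<le> b i) \<and>
        disjoint_family_on (\<lambda>i. {a i<..<b i}) {..<n} \<and> (\<Sum>i<n. b i - a i) < d \<longrightarrow>
        (\<Sum>i<n. norm (f (b i) - f (a i))) < e"
    using \<open>d1 > 0\<close> \<open>d2 > 0\<close> by (intro exI[of _ "min d1 d2"]) auto
qed

lemma abs_continuous_on_ident: "abs_continuous_on S (\<lambda>t. t)"
  unfolding abs_continuous_on_def
proof (intro allI impI)
  fix e :: real assume "e > 0"
  have "(\<Sum>i<n. norm (b i - a i)) < e"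
    if "\<forall>i<n. a i \<in> S \<and> b i \<in> S \<and> a i \<le> b i" "(\<Sum>i<n. b i - a i) < e" for n :: nat and a b :: "nat \<Rightarrow> real"
  proof -
    have "(\<Sum>i<n. norm (b i - a i)) = (\<Sum>i<n. b i - a i)"
      using that by (intro sum.cong) auto
    then show ?thesis using that by simp
  qed
  then show "\<exists>d>0. \<forall>(n::nat) a b. (\<forall>i<n. a i \<in> S \<and> b i \<in> S \<and> a i \<le> b i) \<and>
        disjoint_family_on (\<lambda>i. {a i<..<b i}) {..<n} \<and> (\<Sum>i<n. b i - a i) < d \<longrightarrow>
        (\<Sum>i<n. norm (b i - a i)) < e"
    using \<open>e > 0\<close> by (intro exI[of _ e]) auto
qed

lemma abs_continuous_on_lipschitz:
  assumes "0 \<le> C" "\<And>s t. s \<in> S \<Longrightarrow> t \<in> S \<Longrightarrow> s \<le> t \<Longrightarrow> norm (f t - f s) \<le> C * (t - s)"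
  shows "abs_continuous_on S f"
proof (rule abs_continuous_on_dominated[OF abs_continuous_on_ident abs_continuous_on_ident \<open>0 \<le> C\<close>])
  fix s t assume st: "s \<in> S" "t \<in> S" "s \<le> t"
  have "C * (t - s) \<le> C * (norm (t - s) + norm (t - s))"
    using \<open>0 \<le> C\<close> st by (intro mult_left_mono) auto
  then show "norm (f t - f s) \<le> C * (norm (t - s) + norm (t - s))"
    using assms(2)[OF st] by linarith
qed

lemma abs_continuous_on_const: "abs_continuous_on S (\<lambda>t. c)"
  by (rule abs_continuous_on_lipschitz[of 0]) auto

lemma abs_continuous_on_C1:
  fixes f f' :: "real \<Rightarrow> real"
  assumes "\<And>t. t \<in> {a..b} \<Longrightarrow> (f has_real_derivative f' t) (at t)"
    and "continuous_on {a..b} f'"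
  shows "abs_continuous_on {a..b} f"
proof -
  have "bounded (f' ` {a..b})"
    using assms(2) by (intro compact_imp_bounded compact_continuous_image) auto
  then obtain C where C: "\<And>t. t \<in> {a..b} \<Longrightarrow> norm (f' t) \<le> C" "C > 0"
    by (meson bounded_pos imageI)
  show ?thesis
  proof (rule abs_continuous_on_lipschitz)
    fix s t assume "s \<in> {a..b}" "t \<in> {a..b}" "s \<le> t"
    then have "norm (f t - f s) \<le> C * norm (t - s)"
      using field_differentiable_bound[of "{a..b}" f f' C t s] C(1) assms(1)
      by (meson convex_real_interval(5) has_field_derivative_at_within)
    then show "norm (f t - f s) \<le> C * (t - s)"
      using \<open>s \<le> t\<close> by simp
  qed (use C in simp)
qed

lemma abs_continuous_on_add:
  assumes "abs_continuous_on S f" "abs_continuous_on S g"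
  shows "abs_continuous_on S (\<lambda>t. f t + g t)"
  by (rule abs_continuous_on_dominated[OF assms, of 1])
    (use norm_triangle_ineq in \<open>auto simp: add_diff_add\<close>)

lemma abs_continuous_on_diff:
  assumes "abs_continuous_on S f" "abs_continuous_on S g"
  shows "abs_continuous_on S (\<lambda>t. f t - g t)"
proof (rule abs_continuous_on_dominated[OF assms, of 1])
  fix s t
  have "norm ((f t - g t) - (f s - g s)) = norm ((f t - f s) - (g t - g s))"
    by (simp add: algebra_simps)
  then show "norm ((f t - g t) - (f s - g s)) \<le> 1 * (norm (f t - f s) + norm (g t - g s))"
    using norm_triangle_ineq4[of "f t - f s" "g t - g s"] by simp
qed simp

lemma abs_continuous_on_bilinear:
  assumes "bounded_bilinear pr" and "compact S"
    and f: "abs_continuous_on S f" and g: "abs_continuous_on S g"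
  shows "abs_continuous_on S (\<lambda>t. pr (f t) (g t))"
proof -
  interpret bounded_bilinear pr by fact
  have "bounded (f ` S)" "bounded (g ` S)"
    using assms by (auto intro!: compact_imp_bounded compact_continuous_image
        abs_continuous_on_imp_continuous_on)
  then obtain B1 B2 where "\<forall>u\<in>f ` S. norm u \<le> B1" "B1 > 0" "\<forall>u\<in>g ` S. norm u \<le> B2" "B2 > 0"
    unfolding bounded_pos by blast
  then have B1: "\<And>t. t \<in> S \<Longrightarrow> norm (f t) \<le> B1" "B1 > 0"
    and B2: "\<And>t. t \<in> S \<Longrightarrow> norm (g t) \<le> B2" "B2 > 0"
    by auto
  obtain K where K: "K > 0" "\<And>u v. norm (pr u v) \<le> norm u * norm v * K"
    using pos_bounded by blast
  define B where "B = max B1 B2"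
  show ?thesis
  proof (rule abs_continuous_on_dominated[OF f g, of "B * K"])
    show "0 \<le> B * K" using B1 K by (simp add: B_def)
    fix s t assume st: "s \<in> S" "t \<in> S"
    have "pr (f t) (g t) - pr (f s) (g s) = pr (f t - f s) (g t) + pr (f s) (g t - g s)"
      by (simp add: diff_left diff_right)
    then have "norm (pr (f t) (g t) - pr (f s) (g s))
        \<le> norm (pr (f t - f s) (g t)) + norm (pr (f s) (g t - g s))"
      by (simp add: norm_triangle_ineq)
    also have "\<dots> \<le> norm (f t - f s) * norm (g t) * K + norm (f s) * norm (g t - g s) * K"
      by (intro add_mono K)
    also have "\<dots> \<le> norm (f t - f s) * B * K + B * norm (g t - g s) * K"
      using B1(1)[OF st(1)] B2(1)[OF st(2)] K
      by (intro add_mono mult_right_mono mult_left_mono) (auto simp: B_def)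
    also have "\<dots> = B * K * (norm (f t - f s) + norm (g t - g s))"
      by (simp add: algebra_simps)
    finally show "norm (pr (f t) (g t) - pr (f s) (g s)) \<le> B * K * (norm (f t - f s) + norm (g t - g s))" .
  qed
qed

lemmas abs_continuous_on_mult = abs_continuous_on_bilinear[OF bounded_bilinear_mult]
lemmas abs_continuous_on_scaleR = abs_continuous_on_bilinear[OF bounded_bilinear_scaleR]
lemmas abs_continuous_on_inner = abs_continuous_on_bilinear[OF bounded_bilinear_inner]

lemma abs_continuous_on_norm:
  assumes "abs_continuous_on S f"
  shows "abs_continuous_on S (\<lambda>t. norm (f t))"
  by (rule abs_continuous_on_dominated[OF assms abs_continuous_on_const[of _ "0::real"], of 1])
    (auto intro: norm_triangle_ineq3)

text \<open>Truncation: the absolute value of \<open>f\<close> splits into its minimum with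
  \<open>N\<close> and a remainder \<open>h\<close> whose integral is below \<open>e / 2\<close>.
  The bounded part contributes at most \<open>N\<close> times the total length, uniformly over all
  families of intervals.\<close>

lemma abs_continuous_on_integral:
  fixes f :: "real \<Rightarrow> real"
  assumes f: "f absolutely_integrable_on {a..b}"
  shows "abs_continuous_on {a..b} (\<lambda>t. integral {a..t} f)"
  unfolding abs_continuous_on_def
proof (intro allI impI)
  fix e :: real assume "e > 0"
  define g where "g = (\<lambda>t. \<bar>f t\<bar>)"
  define gN where "gN = (\<lambda>(N::nat) t. min (g t) (real N))"
  have g: "g absolutely_integrable_on {a..b}"
    using f by (auto simp: g_def dest: absolutely_integrable_norm simp: o_def)
  have gi: "g integrable_on {a..b}" using g by (rule set_lebesgue_integral_eq_integral(1))
  have gN: "gN N integrable_on {a..b}" for N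
    unfolding gN_def
    by (intro set_lebesgue_integral_eq_integral(1) absolutely_integrable_min_1 g) auto
  have "(\<lambda>N. integral {a..b} (gN N)) \<longlonglongrightarrow> integral {a..b} g"
  proof (rule dominated_convergence(2)[OF gN gi])
    show "norm (gN k t) \<le> g t" for k t by (auto simp: gN_def g_def)
    show "(\<lambda>k. gN k t) \<longlonglongrightarrow> g t" for t
    proof (rule tendsto_eventually)
      obtain M where "g t \<le> real M" using real_arch_simple by blast
      then show "\<forall>\<^sub>F k in sequentially. gN k t = g t"
        by (intro eventually_sequentiallyI[of M]) (auto simp: gN_def)
    qed
  qed
  then have "\<forall>\<^sub>F N in sequentially. dist (integral {a..b} (gN N)) (integral {a..b} g) < e / 2"
    using \<open>e > 0\<close> by (intro tendstoD) auto
  then obtain N where N: "dist (integral {a..b} (gN N)) (integral {a..b} g) < e / 2"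
    by (meson eventually_sequentially order_refl)
  define h where "h = (\<lambda>t. g t - gN N t)"
  have hi: "h integrable_on {a..b}" and h0: "\<And>t. 0 \<le> h t"
    using gN gi by (auto simp: h_def gN_def intro: integrable_diff)
  have "integral {a..b} h < e / 2"
    using gN[of N] gi N unfolding h_def dist_real_def
    by (subst Henstock_Kurzweil_Integration.integral_diff) linarith+
  have "(\<Sum>i<n. norm (integral {a..B i} f - integral {a..A i} f)) < e"
    if AB: "\<forall>i<n. A i \<in> {a..b} \<and> B i \<in> {a..b} \<and> A i \<le> B i"
      and dis: "disjoint_family_on (\<lambda>i. {A i<..<B i}) {..<n}"
      and sm: "(\<Sum>i<n. B i - A i) < e / (2 * (real N + 1))" for n :: nat and A B
  proof -
    have sub: "{A i<..<B i} \<subseteq> {a..b}" "{A i..B i} \<subseteq> {a..b}" if "i < n" for i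
      using AB that by (auto intro: order_trans less_imp_le)
    have hint: "h integrable_on {A i..B i}" "f integrable_on {A i..B i}"  "g integrable_on {A i..B i}"
      if "i < n" for i
      using hi gi set_lebesgue_integral_eq_integral(1)[OF f] sub[OF that] integrable_on_subinterval by blast+
    have "norm (integral {a..B i} f - integral {a..A i} f) \<le> integral {A i<..<B i} h + real N * (B i - A i)"
      if i: "i < n" for i
    proof -
      have ab: "a \<le> A i" "A i \<le> B i" "B i \<le> b" using AB i by auto
      have "integral {a..A i} f + integral {A i..B i} f = integral {a..B i} f"
        using ab set_lebesgue_integral_eq_integral(1)[OF f]
        by (intro Henstock_Kurzweil_Integration.integral_combine)
          (auto intro: integrable_on_subinterval)
      then have "norm (integral {a..B i} f - integral {a..A i} f) = norm (integral {A i..B i} f)"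
        by (simp add: algebra_simps)
      also have "\<dots> \<le> integral {A i..B i} g"
        using hint[OF i] by (intro integral_norm_bound_integral) (auto simp: g_def)
      also have "\<dots> \<le> integral {A i..B i} (\<lambda>t. h t + real N)"
        using hint[OF i] by (intro integral_le integrable_add) (auto simp: h_def gN_def)
      also have "\<dots> = integral {A i..B i} h + real N * (B i - A i)"
        using hint[OF i] ab by (subst integral_add) (auto simp: integrable_const_ivl)
      \<comment> \<open>Only the open intervals are disjoint; neighbouring closed ones may share end
        points.\<close>
      also have "integral {A i..B i} h = integral {A i<..<B i} h"
        by (simp add: integral_open_interval_real)
      finally show ?thesis .
    qed
    then have "(\<Sum>i<n. norm (integral {a..B i} f - integral {a..A i} f))
        \<le> (\<Sum>i<n. integral {A i<..<B i} h + real N * (B i - A i))"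
      by (intro sum_mono) auto
    also have "\<dots> = (\<Sum>i<n. integral {A i<..<B i} h) + real N * (\<Sum>i<n. B i - A i)"
      by (simp add: sum.distrib sum_distrib_left)
    also have "(\<Sum>i<n. integral {A i<..<B i} h) \<le> integral {a..b} h"
    proof -
      have "(h has_integral (\<Sum>i\<in>{..<n}. integral {A i<..<B i} h)) (\<Union>i\<in>{..<n}. {A i<..<B i})"
        using dis hint(1)
        by (intro has_integral_UN)
          (auto simp: disjoint_family_on_def pairwise_def integrable_on_open_interval_real
            intro!: integrable_integral)
      moreover have "integral (\<Union>i\<in>{..<n}. {A i<..<B i}) h \<le> integral {a..b} h"
        using calculation sub hi h0 by (intro integral_subset_le) (auto simp: has_integral_iff)
      ultimately show ?thesis by (auto simp: has_integral_iff)
    qed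
    also have "real N * (\<Sum>i<n. B i - A i) \<le> (real N + 1) * (\<Sum>i<n. B i - A i)"
      using AB by (intro mult_right_mono sum_nonneg) auto
    also have "(real N + 1) * (\<Sum>i<n. B i - A i) \<le> e / 2"
      using sm by (simp add: field_simps)
    finally show ?thesis using \<open>integral {a..b} h < e / 2\<close> by simp
  qed
  then show "\<exists>d>0. \<forall>(n::nat) A B. (\<forall>i<n. A i \<in> {a..b} \<and> B i \<in> {a..b} \<and> A i \<le> B i) \<and>
        disjoint_family_on (\<lambda>i. {A i<..<B i}) {..<n} \<and> (\<Sum>i<n. B i - A i) < d \<longrightarrow>
        (\<Sum>i<n. norm (integral {a..B i} f - integral {a..A i} f)) < e"
    using \<open>e > 0\<close> by (intro exI[of _ "e / (2 * (real N + 1))"]) auto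
qed

section \<open>Monotonicity and comparison from one-sided derivatives\<close>

text \<open>
  Move to the left from \<open>b\<close>: outside \<open>N\<close> by the Dini condition, on \<open>N\<close> inside an open set \<open>U\<close> of small
  measure, where absolute continuity controls the collected increments. The set of points reached is
  closed, and its infimum can only be \<open>a\<close>.
\<close>

lemma abs_continuous_on_nonincreasing:
  fixes f :: "real \<Rightarrow> real"
  assumes "a \<le> b" and f: "abs_continuous_on {a..b} f" and N: "negligible N"
    and dini: "\<And>t e. \<lbrakk>a < t; t \<le> b; t \<notin> N; 0 < e\<rbrakk>
        \<Longrightarrow> \<exists>d>0. \<forall>s. t - d < s \<and> s < t \<longrightarrow> f t - f s \<le> e * (t - s)"
  shows "f b \<le> f a"
proof (rule field_le_epsilon)
  fix e' :: real assume "e' > 0"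
  \<comment> \<open>Three losses are budgeted: \<open>e * (b - a)\<close> from the Dini slope,
    \<open>e\<close> from the slack \<open>\<eta>\<close>, and \<open>e\<close> from the increments
    across \<open>N\<close>.\<close>
  define e where "e = e' / (b - a + 2)"
  have "e > 0" and "e * (b - a + 2) = e'"
    using \<open>e' > 0\<close> \<open>a \<le> b\<close> by (simp_all add: e_def)
  then have e': "e * (b - a) + e + e = e'"
    by (simp add: algebra_simps)
  obtain d where "d > 0" and d: "\<And>(n::nat) A B. \<lbrakk>\<forall>i<n. A i \<in> {a..b} \<and> B i \<in> {a..b} \<and> A i \<le> B i;
        disjoint_family_on (\<lambda>i. {A i<..<B i}) {..<n}; (\<Sum>i<n. B i - A i) < d\<rbrakk>
        \<Longrightarrow> (\<Sum>i<n. norm (f (B i) - f (A i))) < e"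
    using abs_continuous_onE[OF f \<open>e > 0\<close>] by blast
  have "N \<in> sets lebesgue" using N by (simp add: negligible_imp_sets)
  then obtain U where U: "open U" "N \<subseteq> U" "U - N \<in> lmeasurable" "emeasure lebesgue (U - N) < ennreal d"
    using sets_lebesgue_outer_open \<open>d > 0\<close> by blast
  have Uneg: "negligible (U - (U - N))" "negligible ((U - N) - U)"
    using N by (auto intro: negligible_subset)
  have Um: "U \<in> lmeasurable"
    using U(3) Uneg lmeasurable_negligible_symdiff[of "U - N" U] by (simp add: Un_commute)
  have "measure lebesgue U = measure lebesgue (U - N)"
    using Uneg measure_negligible_symdiff[of "U - N" U] U(3) by (simp add: Un_commute)
  also have "\<dots> < d"
    using U(3,4) \<open>d > 0\<close> by (simp add: emeasure_eq_measure2 fmeasurableD2 ennreal_less_iff)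
  finally have Ud: "measure lebesgue U < d" .
  define family where "family = (\<lambda>t (n::nat) A B. (\<forall>i<n. t \<le> A i \<and> A i \<le> B i \<and> B i \<le> b \<and> {A i..B i} \<subseteq> U)
      \<and> disjoint_family_on (\<lambda>i. {A i<..<B i}) {..<n})"
  \<comment> \<open>The family is chosen after the slack \<open>\<eta>\<close> and may vary with it.
    This is what lets the infimum of \<open>S\<close> belong to \<open>S\<close> without taking a
    limit of families.\<close>
  define P where "P = (\<lambda>t. \<forall>\<eta>>0. \<exists>n A B. family t n A B \<and>
      f b - f t \<le> e * (b - t) + \<eta> + (\<Sum>i<n. norm (f (B i) - f (A i))))"
  define S where "S = {t \<in> {a..b}. P t}"
  have "family b 0 A B" for A B by (simp add: family_def disjoint_family_on_def)
  then have "b \<in> S" using \<open>a \<le> b\<close> by (force simp: S_def P_def)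
  have bdd: "bdd_below S" by (auto simp: S_def intro!: bdd_belowI[of _ a])
  define c where "c = Inf S"
  have c: "a \<le> c" "c \<le> b" "\<And>t. t \<in> S \<Longrightarrow> c \<le> t"
    using \<open>b \<in> S\<close> bdd unfolding c_def
    by (auto intro!: cInf_greatest cInf_lower simp: S_def)
  have mono: "family s n A B" if "family t n A B" "s \<le> t" for s t n A B
    using that by (force simp: family_def)
  have "P c"
    unfolding P_def
  proof (intro allI impI)
    fix \<eta> :: real assume "\<eta> > 0"
    have "continuous_on {a..b} f" using f by (rule abs_continuous_on_imp_continuous_on)
    then obtain r where r: "r > 0" "\<And>s. s \<in> {a..b} \<Longrightarrow> dist s c < r \<Longrightarrow> dist (f s) (f c) < \<eta> / 2"
      using c \<open>\<eta> > 0\<close> unfolding continuous_on_iff by (metis atLeastAtMost_iff half_gt_zero)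
    obtain s where s: "s \<in> S" "s < c + r"
      using cInf_lessD[of S "c + r"] \<open>b \<in> S\<close> r(1) by (auto simp: c_def)
    obtain n A B where AB: "family s n A B"
      "f b - f s \<le> e * (b - s) + \<eta> / 2 + (\<Sum>i<n. norm (f (B i) - f (A i)))"
      using s(1) \<open>\<eta> > 0\<close> by (auto simp: S_def P_def dest: spec[of _ "\<eta> / 2"])
    have "c \<le> s" by (rule c(3)[OF s(1)])
    have "dist (f s) (f c) < \<eta> / 2"
      using r(2)[of s] s \<open>c \<le> s\<close> by (auto simp: S_def dist_real_def)
    moreover have "e * (b - s) \<le> e * (b - c)" using \<open>c \<le> s\<close> \<open>e > 0\<close> by simp
    ultimately have "f b - f c \<le> e * (b - c) + \<eta> + (\<Sum>i<n. norm (f (B i) - f (A i)))"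
      using AB(2) unfolding dist_real_def by linarith
    then show "\<exists>n A B. family c n A B \<and>
      f b - f c \<le> e * (b - c) + \<eta> + (\<Sum>i<n. norm (f (B i) - f (A i)))"
      using mono[OF AB(1) \<open>c \<le> s\<close>] by blast
  qed
  have "c = a"
  proof (rule ccontr)
    assume "c \<noteq> a"
    then have "a < c" using c by simp
    have False if s: "a \<le> s" "s < c" "P s" for s
      using c(3)[of s] c(2) s by (auto simp: S_def)
    moreover have "\<exists>s. a \<le> s \<and> s < c \<and> P s"
    proof (cases "c \<in> N")
      case False
      then obtain r where r: "r > 0" "\<And>s. c - r < s \<Longrightarrow> s < c \<Longrightarrow> f c - f s \<le> e * (c - s)"
        using dini[OF \<open>a < c\<close> c(2)] \<open>e > 0\<close> by blast
      define s where "s = max a (c - r / 2)"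
      have s: "a \<le> s" "s < c" "c - r < s" using \<open>a < c\<close> r(1) by (auto simp: s_def)
      have "P s"
        unfolding P_def
      proof (intro allI impI)
        fix \<eta> :: real assume "\<eta> > 0"
        then obtain n A B where AB: "family c n A B"
          "f b - f c \<le> e * (b - c) + \<eta> + (\<Sum>i<n. norm (f (B i) - f (A i)))"
          using \<open>P c\<close> by (auto simp: P_def)
        have "f b - f s \<le> e * (b - s) + \<eta> + (\<Sum>i<n. norm (f (B i) - f (A i)))"
          using AB(2) r(2)[OF s(3,2)] by (simp add: algebra_simps)
        then show "\<exists>n A B. family s n A B \<and>
            f b - f s \<le> e * (b - s) + \<eta> + (\<Sum>i<n. norm (f (B i) - f (A i)))"
          using mono[OF AB(1)] s(2) by (meson less_imp_le)
      qed
      then show ?thesis using s by blast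
    next
      \<comment> \<open>The Dini condition says nothing here; instead \<open>[s, c]\<close>, an
        interval inside \<open>U\<close>, is appended to the family as its member number
        \<open>n\<close>.\<close>
      case True
      then obtain r where r: "r > 0" "ball c r \<subseteq> U"
        using U(1,2) by (meson open_contains_ball subsetD)
      define s where "s = max a (c - r / 2)"
      have s: "a \<le> s" "s < c" "c - r < s" using \<open>a < c\<close> r(1) by (auto simp: s_def)
      have sU: "{s..c} \<subseteq> U"
        using s r(2) by (auto simp: ball_def dist_real_def subset_iff)
      have "P s"
        unfolding P_def
      proof (intro allI impI)
        fix \<eta> :: real assume "\<eta> > 0"
        then obtain n A B where AB: "family c n A B"
          "f b - f c \<le> e * (b - c) + \<eta> + (\<Sum>i<n. norm (f (B i) - f (A i)))"
          using \<open>P c\<close> by (auto simp: P_def)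
        have "disjoint_family_on (\<lambda>i. {(A(n := s)) i<..<(B(n := c)) i}) {..<Suc n}"
          using AB(1) unfolding family_def disjoint_family_on_def
          by (auto simp: less_Suc_eq disjoint_iff)
        then have fam: "family s (Suc n) (A(n := s)) (B(n := c))"
          using AB(1) s sU c(2) unfolding family_def by (auto simp: less_Suc_eq)
        have "(\<Sum>i<Suc n. norm (f ((B(n := c)) i) - f ((A(n := s)) i)))
            = (\<Sum>i<n. norm (f (B i) - f (A i))) + norm (f c - f s)"
          by simp
        moreover have "e * (b - c) \<le> e * (b - s)" using s \<open>e > 0\<close> by simp
        ultimately have "f b - f s \<le> e * (b - s) + \<eta> + (\<Sum>i<Suc n. norm (f ((B(n := c)) i) - f ((A(n := s)) i)))"
          using AB(2) by simp
        then show "\<exists>n A B. family s n A B \<and>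
            f b - f s \<le> e * (b - s) + \<eta> + (\<Sum>i<n. norm (f (B i) - f (A i)))"
          using fam by blast
      qed
      then show ?thesis using s by blast
    qed
    ultimately show False by blast
  qed
  then obtain n A B where AB: "family a n A B"
      "f b - f a \<le> e * (b - a) + e + (\<Sum>i<n. norm (f (B i) - f (A i)))"
    using \<open>P c\<close> \<open>e > 0\<close> by (auto simp: P_def)
  \<comment> \<open>The open intervals are disjoint and lie in \<open>U\<close>, so their total
    length is below \<open>d\<close> and absolute continuity bounds the collected
    increments.\<close>
  have "(\<Sum>i<n. B i - A i) = (\<Sum>i<n. measure lebesgue {A i<..<B i})"
    using AB(1) by (intro sum.cong) (auto simp: family_def)
  also have "\<dots> = measure lebesgue (\<Union>i<n. {A i<..<B i})"
    using AB(1) by (intro measure_finite_Union[symmetric]) (auto simp: family_def)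
  also have "\<dots> \<le> measure lebesgue U"
    using AB(1) Um by (intro measure_mono_fmeasurable) (force simp: family_def)+
  also have "\<dots> < d" by (rule Ud)
  finally have "(\<Sum>i<n. norm (f (B i) - f (A i))) < e"
    using AB(1) by (intro d) (force simp: family_def)+
  then show "f b \<le> f a + e'" using AB(2) e' by linarith
qed

text \<open>Lebesgue differentiation in one-sided form.
  \<open>integrable_ccontinuous_explicit\<close> averages over boxes to the right of a point, so it
  is applied to the reflection of \<open>k\<close>, whose right-hand averages are the left-hand
  averages of \<open>k\<close>.\<close>

lemma indefinite_integral_left_derivative:
  fixes k :: "real \<Rightarrow> real"
  assumes k: "k integrable_on {a..b}"
  obtains N where "negligible N"
    "\<And>t e. \<lbrakk>a < t; t \<le> b; t \<notin> N; 0 < e\<rbrakk> \<Longrightarrow> \<exists>d>0. \<forall>s. t - d < s \<and> s < t \<longrightarrow>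
        \<bar>integral {a..t} k - integral {a..s} k - k t * (t - s)\<bar> \<le> e * (t - s)"
proof -
  \<comment> \<open>Extension by zero makes the reflected function integrable on every box, as the
    differentiation theorem requires.\<close>
  define K where "K = (\<lambda>t. if t \<in> {a..b} then k t else 0)"
  have "K integrable_on UNIV"
    using k integrable_restrict_UNIV[of "{a..b}" k] by (simp add: K_def)
  then have "K integrable_on {- d..- c}" for c d
    by (rule integrable_on_subinterval) simp
  then have int: "(\<lambda>t. K (- t)) integrable_on cbox c d" for c d
    using Henstock_Kurzweil_Integration.integrable_reflect_real[where f = K and a = "- d" and b = "- c"] by simp
  obtain N where N: "negligible N" "\<And>x e. \<lbrakk>x \<notin> N; 0 < e\<rbrakk> \<Longrightarrow> \<exists>d>0. \<forall>h. 0 < h \<and> h < d \<longrightarrow>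
        norm (integral (cbox x (x + h *\<^sub>R One)) (\<lambda>t. K (- t)) /\<^sub>R h ^ DIM(real) - K (- x)) < e"
    by (rule integrable_ccontinuous_explicit[OF int]) blast
  show ?thesis
  proof (rule that[of "uminus ` N"])
    show "negligible (uminus ` N)"
      using N(1) by (intro negligible_differentiable_image_negligible) (auto intro!: derivative_intros)
    fix t e :: real assume t: "a < t" "t \<le> b" "t \<notin> uminus ` N" and "0 < e"
    then have "- t \<notin> N" by force
    then obtain d where d: "d > 0" "\<And>h. 0 < h \<and> h < d \<Longrightarrow>
        \<bar>integral {- t..- t + h} (\<lambda>t. K (- t)) / h - K t\<bar> < e"
      using N(2)[of "- t" e] \<open>0 < e\<close> by (auto simp: divide_inverse_commute)
    have "\<bar>integral {a..t} k - integral {a..s} k - k t * (t - s)\<bar> \<le> e * (t - s)"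
      if s: "t - min d (t - a) < s" "s < t" for s
    proof -
      have as: "a \<le> s" using s by (simp add: min_def split: if_splits)
      have "integral {a..s} k + integral {s..t} k = integral {a..t} k"
        using as s t k
        by (intro Henstock_Kurzweil_Integration.integral_combine)
          (auto intro: integrable_on_subinterval)
      moreover have "integral {s..t} k = integral {s..t} K"
        using as t by (intro integral_cong) (auto simp: K_def)
      moreover have "integral {s..t} K = integral {- t..- s} (\<lambda>t. K (- t))"
        by simp
      moreover have "\<bar>integral {- t..- s} (\<lambda>t. K (- t)) / (t - s) - K t\<bar> < e"
        using d(2)[of "t - s"] s by simp
      moreover have "K t = k t" using t by (simp add: K_def)
      ultimately have "\<bar>(integral {a..t} k - integral {a..s} k) / (t - s) - k t\<bar> \<le> e"
        by (metis add_diff_cancel_left' less_imp_le)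
      moreover have "(integral {a..t} k - integral {a..s} k) - k t * (t - s)
          = ((integral {a..t} k - integral {a..s} k) / (t - s) - k t) * (t - s)"
        using s by (simp add: field_simps)
      ultimately show ?thesis
        using s by (simp add: abs_mult mult_right_mono)
    qed
    then show "\<exists>d>0. \<forall>s. t - d < s \<and> s < t \<longrightarrow>
        \<bar>integral {a..t} k - integral {a..s} k - k t * (t - s)\<bar> \<le> e * (t - s)"
      using d(1) t(1) by (intro exI[of _ "min d (t - a)"]) auto
  qed
qed

text \<open>Since \<open>q\<close> lies below \<open>f\<close> to the left of \<open>t\<close> and
  agrees with it at \<open>t\<close>, one has \<open>f t - f s \<le> q t - q s\<close>. The
  derivative of \<open>q\<close> therefore bounds the left difference quotients of \<open>f\<close>,
  and \<open>f\<close> minus the indefinite integral of \<open>k\<close> meets the Dini condition.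
  Differentiability is asked of \<open>q\<close> only.\<close>

lemma abs_continuous_on_increment_le_integral:
  fixes f k :: "real \<Rightarrow> real"
  assumes "a \<le> b" and f: "abs_continuous_on {a..b} f" and N: "negligible N"
    and k: "k absolutely_integrable_on {a..b}"
    and touch: "\<And>t. \<lbrakk>a < t; t < b; t \<notin> N\<rbrakk> \<Longrightarrow> \<exists>q D. (q has_real_derivative D) (at t) \<and> D \<le> k t
        \<and> q t = f t \<and> (\<forall>s\<in>{a..<t}. q s \<le> f s)"
  shows "f b - f a \<le> integral {a..b} k"
proof -
  obtain N' where N': "negligible N'"
    "\<And>t e. \<lbrakk>a < t; t \<le> b; t \<notin> N'; 0 < e\<rbrakk> \<Longrightarrow> \<exists>d>0. \<forall>s. t - d < s \<and> s < t \<longrightarrow>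
        \<bar>integral {a..t} k - integral {a..s} k - k t * (t - s)\<bar> \<le> e * (t - s)"
    using indefinite_integral_left_derivative[OF set_lebesgue_integral_eq_integral(1)[OF k]] by blast
  define F where "F = (\<lambda>t. f t - integral {a..t} k)"
  have "F b \<le> F a"
  proof (rule abs_continuous_on_nonincreasing[OF \<open>a \<le> b\<close>])
    show "abs_continuous_on {a..b} F"
      unfolding F_def by (intro abs_continuous_on_diff f abs_continuous_on_integral k)
    \<comment> \<open>\<open>touch\<close> is silent at \<open>b\<close>, whereas the Dini condition
      reaches up to \<open>b\<close>; the single point joins the exceptional set.\<close>
    show "negligible (insert b (N \<union> N'))" using N N'(1) by simp
    fix t e :: real assume t: "a < t" "t \<le> b" "t \<notin> insert b (N \<union> N')" and "e > 0"
    obtain q D where q: "(q has_real_derivative D) (at t)" "D \<le> k t" "q t = f t"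
        "\<And>s. s \<in> {a..<t} \<Longrightarrow> q s \<le> f s"
      using touch[of t] t by auto
    obtain d1 where d1: "d1 > 0" "\<And>s. t - d1 < s \<Longrightarrow> s < t \<Longrightarrow>
        \<bar>integral {a..t} k - integral {a..s} k - k t * (t - s)\<bar> \<le> (e / 2) * (t - s)"
      using N'(2)[of t "e / 2"] t \<open>e > 0\<close> by auto
    obtain d2 where d2: "d2 > 0" "\<And>s. s \<noteq> t \<Longrightarrow> norm (s - t) < d2 \<Longrightarrow>
        norm ((q s - q t) / (s - t) - D) < e / 2"
      using q(1) \<open>e > 0\<close> unfolding has_field_derivative_iff LIM_eq by (metis half_gt_zero)
    \<comment> \<open>Half of \<open>e\<close> pays for the difference quotient of \<open>q\<close>,
      the other half for that of the integral.\<close>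
    have "F t - F s \<le> e * (t - s)" if s: "t - min (t - a) (min d1 d2) < s" "s < t" for s
    proof -
      have "a \<le> s" using s by (auto simp: min_def split: if_splits)
      have "(q s - q t) / (s - t) - D < e / 2"
        using d2(2)[of s] s unfolding real_norm_def by linarith
      then have "(q s - q t) / (s - t) < k t + e / 2" using q(2) by linarith
      then have "(k t + e / 2) * (s - t) < q s - q t"
        using s by (simp add: neg_divide_less_eq)
      moreover have "(k t + e / 2) * (s - t) = - (k t * (t - s)) - (e / 2) * (t - s)"
        by (simp add: field_simps)
      moreover have "q s \<le> f s" using q(4)[of s] \<open>a \<le> s\<close> s by simp
      moreover have "k t * (t - s) - (e / 2) * (t - s) \<le> integral {a..t} k - integral {a..s} k"
        using d1(2)[of s] s by linarith
      moreover have "e * (t - s) = (e / 2) * (t - s) + (e / 2) * (t - s)"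
        by (simp add: field_simps)
      ultimately show ?thesis
        using q(3) unfolding F_def by linarith
    qed
    then show "\<exists>d>0. \<forall>s. t - d < s \<and> s < t \<longrightarrow> F t - F s \<le> e * (t - s)"
      using t d1(1) d2(1) by (intro exI[of _ "min (t - a) (min d1 d2)"]) auto
  qed
  then show ?thesis by (simp add: F_def)
qed

text \<open>The norm has no derivative at zero, but linear functionals support it from below: with
  \<open>z = sgn (g t - g a)\<close> the touching function is
  \<open>z \<bullet> (g s - g a)\<close>. If \<open>g t = g a\<close>, the convention
  \<open>sgn 0 = 0\<close> makes it the zero function.\<close>

lemma norm_abs_continuous_on_increment_le_integral:
  fixes g :: "real \<Rightarrow> 'a::real_inner" and k :: "real \<Rightarrow> real"
  assumes "a \<le> b" and g: "abs_continuous_on {a..b} g" and "negligible N"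
    and "k absolutely_integrable_on {a..b}"
    and g': "\<And>t. \<lbrakk>a < t; t < b; t \<notin> N\<rbrakk> \<Longrightarrow> \<exists>D. (g has_vector_derivative D) (at t) \<and> norm D \<le> k t"
  shows "norm (g b - g a) \<le> integral {a..b} k"
proof -
  have "norm (g b - g a) - norm (g a - g a) \<le> integral {a..b} k"
  proof (rule abs_continuous_on_increment_le_integral[OF assms(1) _ assms(3,4)])
    show "abs_continuous_on {a..b} (\<lambda>t. norm (g t - g a))"
      by (intro abs_continuous_on_norm abs_continuous_on_diff g abs_continuous_on_const)
    fix t assume t: "a < t" "t < b" "t \<notin> N"
    obtain D where D: "(g has_vector_derivative D) (at t)" "norm D \<le> k t"
      using g'[OF t] by blast
    define z where "z = sgn (g t - g a)"
    have z: "norm z \<le> 1" "z \<bullet> (g t - g a) = norm (g t - g a)"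
      by (cases "g t = g a"; simp add: z_def norm_sgn; simp add: sgn_div_norm dot_square_norm power2_eq_square)+
    have le: "z \<bullet> u \<le> norm u" for u
      using norm_cauchy_schwarz[of z u] mult_right_mono[OF z(1), of "norm u"] by simp
    have "((\<lambda>s. z \<bullet> (g s - g a)) has_real_derivative z \<bullet> D) (at t)"
      unfolding has_real_derivative_iff_has_vector_derivative
      by (intro bounded_linear.has_vector_derivative[OF bounded_linear_inner_right])
        (auto intro!: derivative_eq_intros D)
    then show "\<exists>q E. (q has_real_derivative E) (at t) \<and> E \<le> k t
        \<and> q t = norm (g t - g a) \<and> (\<forall>s\<in>{a..<t}. q s \<le> norm (g s - g a))"
      using z(2) le order_trans[OF le D(2)] by blast
  qed
  then show ?thesis by simp
qed

subsection \<open>Subgradients along a curve\<close>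

text \<open>The square of \<open>r t - m\<close> has nonnegative integral, where \<open>m\<close> is
  the mean of \<open>r\<close>; expanding it gives the estimate.\<close>

lemma integral_Cauchy_Schwarz_interval:
  fixes r :: "real \<Rightarrow> real"
  assumes "c \<le> d" and r: "r integrable_on {c..d}" and r2: "(\<lambda>t. (r t)\<^sup>2) integrable_on {c..d}"
  shows "(integral {c..d} r)\<^sup>2 \<le> (d - c) * integral {c..d} (\<lambda>t. (r t)\<^sup>2)"
proof (cases "c = d")
  case False
  then have "c < d" using \<open>c \<le> d\<close> by simp
  define m where "m = integral {c..d} r / (d - c)"
  have "((\<lambda>t. ((r t)\<^sup>2 - (2 * m) * r t) + m\<^sup>2) has_integral
      ((integral {c..d} (\<lambda>t. (r t)\<^sup>2) - (2 * m) * integral {c..d} r) + m\<^sup>2 * (d - c))) {c..d}"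
    using has_integral_const_real[of "m\<^sup>2" c d] \<open>c \<le> d\<close>
    by (intro has_integral_add has_integral_diff has_integral_mult_right integrable_integral r r2)
      (simp add: mult.commute)
  moreover have "0 \<le> ((r t)\<^sup>2 - (2 * m) * r t) + m\<^sup>2" for t
    using zero_le_power2[of "r t - m"] by (simp add: power2_eq_square algebra_simps)
  ultimately have "0 \<le> (integral {c..d} (\<lambda>t. (r t)\<^sup>2) - (2 * m) * integral {c..d} r) + m\<^sup>2 * (d - c)"
    by (rule has_integral_nonneg)
  also have "m\<^sup>2 * (d - c) = m * integral {c..d} r"
    using \<open>c < d\<close> by (simp add: m_def power2_eq_square)
  finally have "m * integral {c..d} r \<le> integral {c..d} (\<lambda>t. (r t)\<^sup>2)" by simp
  then have "(d - c) * (m * integral {c..d} r) \<le> (d - c) * integral {c..d} (\<lambda>t. (r t)\<^sup>2)"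
    using \<open>c \<le> d\<close> by (intro mult_left_mono) auto
  moreover have "(d - c) * (m * integral {c..d} r) = (integral {c..d} r)\<^sup>2"
    using \<open>c < d\<close> by (simp add: m_def power2_eq_square)
  ultimately show ?thesis by simp
qed simp

text \<open>If \<open>f\<close> exceeded the enlarged mean everywhere, integrating that lower bound
  would contradict \<open>e > 0\<close>. With the slack \<open>e\<close> the weak monotonicity of
  the integral suffices.\<close>

lemma exists_le_integral_mean:
  fixes f :: "real \<Rightarrow> real"
  assumes "c < d" "f integrable_on {c..d}" "0 < e"
  shows "\<exists>t\<in>{c..d}. (d - c) * f t \<le> integral {c..d} f + e"
proof (rule ccontr)
  assume "\<not> ?thesis"
  then have gt: "integral {c..d} f + e < (d - c) * f t" if "t \<in> {c..d}" for t
    using that by force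
  have "integral {c..d} (\<lambda>t. (integral {c..d} f + e) / (d - c)) \<le> integral {c..d} f"
    using gt assms(1,2) by (intro integral_le) (auto simp: divide_simps mult.commute less_imp_le)
  then show False using assms(1,3) by simp
qed

text \<open>
  Summing the subgradient inequality over a partition bounds the increment of \<open>w\<close>, provided that the
  partition points are chosen where the subgradient does not exceed its mean; at the fixed end
  point \<open>b\<close> the subgradient may be large, but there the increment of \<open>x\<close> is small.
\<close>

lemma subgradient_increment_le_integral:
  fixes w r :: "real \<Rightarrow> real" and x \<xi> :: "real \<Rightarrow> 'a::real_inner"
  assumes "a \<le> b"
    and sub: "\<And>s t. \<lbrakk>s \<in> {a..b}; t \<in> {a..b}\<rbrakk> \<Longrightarrow> w t - w s \<le> \<xi> t \<bullet> (x t - x s)"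
    and \<xi>: "\<And>t. t \<in> {a..b} \<Longrightarrow> norm (\<xi> t) \<le> r t"
    and x: "\<And>s t. \<lbrakk>a \<le> s; s \<le> t; t \<le> b\<rbrakk> \<Longrightarrow> norm (x t - x s) \<le> integral {s..t} r"
    and r: "r integrable_on {a..b}" and r2: "(\<lambda>t. (r t)\<^sup>2) integrable_on {a..b}"
  shows "w b - w a \<le> 2 * integral {a..b} (\<lambda>t. (r t)\<^sup>2)"
proof (cases "a = b")
  case False
  then have "a < b" using \<open>a \<le> b\<close> by simp
  define M where "M = (\<lambda>t. integral {a..t} (\<lambda>t. (r t)\<^sup>2))"
  have M_diff: "M t - M s = integral {s..t} (\<lambda>t. (r t)\<^sup>2)" if "a \<le> s" "s \<le> t" "t \<le> b" for s t
  proof -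
    have "integral {a..s} (\<lambda>t. (r t)\<^sup>2) + integral {s..t} (\<lambda>t. (r t)\<^sup>2) = M t"
      using that unfolding M_def
      by (intro Henstock_Kurzweil_Integration.integral_combine integrable_on_subinterval[OF r2]) auto
    then show ?thesis by (simp add: M_def)
  qed
  have "M a = 0" by (simp add: M_def)
  have M_mono: "M s \<le> M t" if "a \<le> s" "s \<le> t" "t \<le> b" for s t
  proof -
    have "0 \<le> integral {s..t} (\<lambda>t. (r t)\<^sup>2)"
      using that by (intro integral_nonneg integrable_on_subinterval[OF r2]) auto
    then show ?thesis using M_diff[OF that] by simp
  qed
  have x_sq: "(norm (x t - x s))\<^sup>2 \<le> (t - s) * (M t - M s)" if "a \<le> s" "s \<le> t" "t \<le> b" for s t
  proof -
    have "(norm (x t - x s))\<^sup>2 \<le> (integral {s..t} r)\<^sup>2"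
      using x[OF that] by (intro power_mono) auto
    also have "\<dots> \<le> (t - s) * integral {s..t} (\<lambda>t. (r t)\<^sup>2)"
      using that
      by (intro integral_Cauchy_Schwarz_interval integrable_on_subinterval[OF r]
          integrable_on_subinterval[OF r2]) auto
    finally show ?thesis using M_diff[OF that] by simp
  qed
  \<comment> \<open>Young's inequality with a free weight \<open>c\<close>: on the grid
    \<open>c\<close> is the mesh width, on the last piece it is adapted to
    \<open>r b\<close>.\<close>
  have w_le: "w t - w s \<le> (c * (r t)\<^sup>2 + (norm (x t - x s))\<^sup>2 / c) / 2"
    if "s \<in> {a..b}" "t \<in> {a..b}" "0 < c" for s t c
  proof -
    have "0 \<le> (c * r t - norm (x t - x s))\<^sup>2 / c" using that by simp
    also have "\<dots> = c * (r t)\<^sup>2 + (norm (x t - x s))\<^sup>2 / c - 2 * (r t * norm (x t - x s))"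
      using that by (simp add: power2_eq_square field_simps)
    finally have "r t * norm (x t - x s) \<le> (c * (r t)\<^sup>2 + (norm (x t - x s))\<^sup>2 / c) / 2"
      by simp
    moreover have "\<xi> t \<bullet> (x t - x s) \<le> r t * norm (x t - x s)"
      using norm_cauchy_schwarz[of "\<xi> t" "x t - x s"] \<xi>[OF that(2)]
      by (meson mult_right_mono norm_ge_zero order_trans)
    ultimately show ?thesis using sub[OF that(1,2)] by linarith
  qed
  have "w b - w a \<le> 2 * M b + 2 * e" if "e > 0" for e
  proof -
    \<comment> \<open>\<open>n\<close> is made so large that on the last piece
      \<open>h * M b \<le> e * c\<close>, with the \<open>c\<close> defined there.\<close>
    obtain n0 where n0: "(b - a) * M b * ((r b)\<^sup>2 + 1) / e\<^sup>2 \<le> real n0"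
      using real_arch_simple by blast
    define n where "n = Suc n0"
    define h where "h = (b - a) / n"
    have "n > 0" and "h > 0" using \<open>a < b\<close> by (auto simp: n_def h_def)
    have nh: "a + real n * h = b" using \<open>n > 0\<close> by (simp add: h_def)
    have grid: "a + real i * h \<le> b" if "i \<le> n" for i
    proof -
      have "real i * h \<le> real n * h" using that \<open>h > 0\<close> by (intro mult_right_mono) auto
      then show ?thesis using nh by linarith
    qed
    have "\<exists>t\<in>{a + real i * h..a + real (Suc i) * h}.
        h * (r t)\<^sup>2 \<le> M (a + real (Suc i) * h) - M (a + real i * h) + e / n" if "i < n" for i
    proof -
      have "a \<le> a + real i * h" "a + real i * h < a + real (Suc i) * h" "a + real (Suc i) * h \<le> b"
        using grid[of "Suc i"] that \<open>h > 0\<close> by (auto simp: algebra_simps)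
      moreover have "a + real (Suc i) * h - (a + real i * h) = h" by (simp add: algebra_simps)
      ultimately show ?thesis
        using exists_le_integral_mean[of "a + real i * h" "a + real (Suc i) * h" "\<lambda>t. (r t)\<^sup>2" "e / n"]
          M_diff[of "a + real i * h" "a + real (Suc i) * h"] \<open>e > 0\<close> \<open>n > 0\<close>
          integrable_on_subinterval[OF r2, of "a + real i * h" "a + real (Suc i) * h"]
        by auto
    qed
    then obtain \<tau> where \<tau>: "\<And>i. i < n \<Longrightarrow> \<tau> i \<in> {a + real i * h..a + real (Suc i) * h}"
      "\<And>i. i < n \<Longrightarrow> h * (r (\<tau> i))\<^sup>2 \<le> M (a + real (Suc i) * h) - M (a + real i * h) + e / n"
      by metis
    \<comment> \<open>The start \<open>a\<close> is prepended. For positive \<open>i\<close>,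
      \<open>\<sigma> i\<close> lies in the cell ending at \<open>a + real i * h\<close>, so
      neighbours are at most \<open>2 * h\<close> apart. The subgradient inequality is always taken
      at the later of two points, so \<open>\<sigma> 0 = a\<close> requires no estimate of
      \<open>r\<close>.\<close>
    define \<sigma> where "\<sigma> = (\<lambda>i. case i of 0 \<Rightarrow> a | Suc j \<Rightarrow> \<tau> j)"
    have \<sigma>: "a + (real i - 1) * h \<le> \<sigma> i" "\<sigma> i \<le> a + real i * h" "a \<le> \<sigma> i" "\<sigma> i \<le> b" if "i \<le> n" for i
    proof -
      have "a + (real i - 1) * h \<le> \<sigma> i \<and> \<sigma> i \<le> a + real i * h \<and> a \<le> \<sigma> i"
      proof (cases i)
        case 0
        then show ?thesis using \<open>h > 0\<close> by (simp add: \<sigma>_def)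
      next
        case (Suc j)
        then have "a + real j * h \<le> \<tau> j" "\<tau> j \<le> a + real (Suc j) * h" "0 \<le> real j * h"
          using \<tau>(1)[of j] that \<open>h > 0\<close> by auto
        then show ?thesis using Suc by (simp add: \<sigma>_def)
      qed
      then show "a + (real i - 1) * h \<le> \<sigma> i" "\<sigma> i \<le> a + real i * h" "a \<le> \<sigma> i" "\<sigma> i \<le> b"
        using grid[OF that] by auto
    qed
    \<comment> \<open>Young with weight \<open>h\<close> bounds each step by half of a cell
      increment of \<open>M\<close>, up to \<open>e / n\<close>, plus the increment of
      \<open>M\<close> between neighbouring points, where the gap \<open>2 * h\<close> enters. Both
      parts telescope; their total factor 3/2 stays below 2.\<close>
    have partial: "w (\<sigma> j) - w a \<le> (M (a + real j * h) + j * (e / n)) / 2 + M (\<sigma> j)" if "j \<le> n" for j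
      using that
    proof (induction j)
      case 0
      then show ?case using \<open>M a = 0\<close> by (simp add: \<sigma>_def)
    next
      case (Suc j)
      then have j: "j < n" "j \<le> n" by auto
      have ord: "\<sigma> j \<le> \<sigma> (Suc j)" "\<sigma> (Suc j) - \<sigma> j \<le> 2 * h"
        using \<sigma>(1,2)[of j] \<sigma>(1,2)[of "Suc j"] Suc.prems by (auto simp: algebra_simps)
      have "(norm (x (\<sigma> (Suc j)) - x (\<sigma> j)))\<^sup>2 \<le> (\<sigma> (Suc j) - \<sigma> j) * (M (\<sigma> (Suc j)) - M (\<sigma> j))"
        using \<sigma>[of j] \<sigma>[of "Suc j"] Suc.prems ord by (intro x_sq) auto
      also have "\<dots> \<le> 2 * h * (M (\<sigma> (Suc j)) - M (\<sigma> j))"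
        using \<sigma>[of j] \<sigma>[of "Suc j"] Suc.prems ord M_mono[of "\<sigma> j" "\<sigma> (Suc j)"]
        by (intro mult_right_mono) auto
      finally have "(norm (x (\<sigma> (Suc j)) - x (\<sigma> j)))\<^sup>2 / h \<le> 2 * (M (\<sigma> (Suc j)) - M (\<sigma> j))"
        using \<open>h > 0\<close> by (subst pos_divide_le_eq) (auto simp: algebra_simps)
      moreover have "w (\<sigma> (Suc j)) - w (\<sigma> j)
          \<le> (h * (r (\<sigma> (Suc j)))\<^sup>2 + (norm (x (\<sigma> (Suc j)) - x (\<sigma> j)))\<^sup>2 / h) / 2"
        using \<sigma>[of j] \<sigma>[of "Suc j"] Suc.prems \<open>h > 0\<close> by (intro w_le) auto
      moreover have "h * (r (\<sigma> (Suc j)))\<^sup>2 \<le> M (a + real (Suc j) * h) - M (a + real j * h) + e / n"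
        using \<tau>(2)[OF j(1)] by (simp add: \<sigma>_def)
      moreover have "real (Suc j) * (e / n) = real j * (e / n) + e / n"
        by (simp add: algebra_simps add_divide_distrib)
      ultimately show ?case using Suc.IH[OF j(2)] by argo
    qed
    have "w (\<sigma> n) - w a \<le> (M b + e) / 2 + M (\<sigma> n)"
      using partial[of n] nh \<open>n > 0\<close> by simp
    moreover have Mn: "M (\<sigma> n) \<le> M b" using \<sigma>[of n] by (intro M_mono) auto
    moreover have "0 \<le> M b" using M_mono[of a b] \<open>M a = 0\<close> \<open>a \<le> b\<close> by simp
    moreover have "w b - w (\<sigma> n) \<le> e"
    proof -
      \<comment> \<open>This gives \<open>c * (r b)\<^sup>2 \<le> e\<close> whatever the size of
        \<open>r b\<close>; the summand 1 covers \<open>r b = 0\<close>.\<close>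
      define c where "c = e / ((r b)\<^sup>2 + 1)"
      have r1: "(r b)\<^sup>2 + 1 > 0" by (simp add: add_nonneg_pos)
      then have "c > 0" using \<open>e > 0\<close> by (simp add: c_def)
      have cr: "c * (r b)\<^sup>2 \<le> e"
        using \<open>e > 0\<close> r1 by (simp add: c_def divide_simps)
      have "0 \<le> M (\<sigma> n)" using \<sigma>[of n] M_mono[of a "\<sigma> n"] \<open>M a = 0\<close> by simp
      have "b - \<sigma> n \<le> h" using \<sigma>(1)[of n] nh by (simp add: algebra_simps)
      have "(norm (x b - x (\<sigma> n)))\<^sup>2 \<le> (b - \<sigma> n) * (M b - M (\<sigma> n))"
        using \<sigma>[of n] by (intro x_sq) auto
      also have "\<dots> \<le> h * M b"
        using \<sigma>[of n] \<open>b - \<sigma> n \<le> h\<close> \<open>0 \<le> M (\<sigma> n)\<close> Mn \<open>h > 0\<close>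
        by (intro mult_mono) auto
      also have "\<dots> \<le> e * c"
      proof -
        have "(b - a) * M b * ((r b)\<^sup>2 + 1) / e\<^sup>2 \<le> real n" using n0 by (simp add: n_def)
        then have "(b - a) * M b * ((r b)\<^sup>2 + 1) \<le> real n * e\<^sup>2"
          using \<open>e > 0\<close> by (simp add: divide_le_eq)
        then have "(b - a) * M b \<le> real n * e\<^sup>2 / ((r b)\<^sup>2 + 1)"
          using r1 by (simp add: le_divide_eq)
        also have "\<dots> = (e * c) * real n" by (simp add: c_def power2_eq_square)
        finally show ?thesis using \<open>n > 0\<close> by (simp add: h_def divide_le_eq)
      qed
      finally have "(norm (x b - x (\<sigma> n)))\<^sup>2 / c \<le> e"
        using \<open>c > 0\<close> by (simp add: divide_le_eq)
      moreover have "w b - w (\<sigma> n) \<le> (c * (r b)\<^sup>2 + (norm (x b - x (\<sigma> n)))\<^sup>2 / c) / 2"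
        using \<sigma>[of n] \<open>c > 0\<close> \<open>a \<le> b\<close> by (intro w_le) auto
      ultimately show ?thesis using cr by argo
    qed
    ultimately show ?thesis using \<open>e > 0\<close> by argo
  qed
  then have "w b - w a \<le> 2 * M b + e" if "e > 0" for e
    using that[THEN half_gt_zero] by fastforce
  then show ?thesis unfolding M_def by (rule field_le_epsilon)
qed simp

text \<open>The increment bound is one-sided, while absolute continuity needs both signs. Reversing
  time turns a decrease of \<open>w\<close> into an increase, and the reflected data satisfy the
  same hypotheses.\<close>

lemma subgradient_abs_continuous:
  fixes w r :: "real \<Rightarrow> real" and x \<xi> :: "real \<Rightarrow> 'a::real_inner"
  assumes sub: "\<And>s t. \<lbrakk>s \<in> {a..b}; t \<in> {a..b}\<rbrakk> \<Longrightarrow> w t - w s \<le> \<xi> t \<bullet> (x t - x s)"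
    and \<xi>: "\<And>t. t \<in> {a..b} \<Longrightarrow> norm (\<xi> t) \<le> r t"
    and x: "\<And>s t. \<lbrakk>a \<le> s; s \<le> t; t \<le> b\<rbrakk> \<Longrightarrow> norm (x t - x s) \<le> integral {s..t} r"
    and r: "r integrable_on {a..b}" and r2: "(\<lambda>t. (r t)\<^sup>2) integrable_on {a..b}"
  shows "abs_continuous_on {a..b} w"
proof -
  define M where "M = (\<lambda>t. integral {a..t} (\<lambda>t. (r t)\<^sup>2))"
  have M: "abs_continuous_on {a..b} M"
    unfolding M_def by (intro abs_continuous_on_integral nonnegative_absolutely_integrable_1 r2) auto
  \<comment> \<open>Using \<open>M\<close> in both slots encodes the factor 2 with constant
    1.\<close>
  show ?thesis
  proof (rule abs_continuous_on_dominated[OF M M])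
    fix s t assume st: "s \<in> {a..b}" "t \<in> {a..b}" "s \<le> t"
    have sub_int: "{s..t} \<subseteq> {a..b}" "a \<le> s" "t \<le> b" using st by auto
    have "integral {a..s} (\<lambda>t. (r t)\<^sup>2) + integral {s..t} (\<lambda>t. (r t)\<^sup>2) = M t"
      using st unfolding M_def
      by (intro Henstock_Kurzweil_Integration.integral_combine integrable_on_subinterval[OF r2]) auto
    then have M_diff: "M t - M s = integral {s..t} (\<lambda>t. (r t)\<^sup>2)" by (simp add: M_def)
    have ri: "r integrable_on {s..t}" "(\<lambda>t. (r t)\<^sup>2) integrable_on {s..t}"
      using integrable_on_subinterval[OF r sub_int(1)] integrable_on_subinterval[OF r2 sub_int(1)] .
    have "w t - w s \<le> 2 * (M t - M s)"
      unfolding M_diff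
    proof (rule subgradient_increment_le_integral[where x = x and \<xi> = \<xi>])
    qed (use st sub \<xi> x ri in auto)
    moreover have "w s - w t \<le> 2 * (M t - M s)"
    proof -
      have refl: "integral {- v..- u} (\<lambda>t. f (- t)) = integral {u..v} f" for u v :: real and f :: "real \<Rightarrow> real"
        by (rule Henstock_Kurzweil_Integration.integral_reflect_real)
      have "w (- (- s)) - w (- (- t)) \<le> 2 * integral {- t..- s} (\<lambda>t. (r (- t))\<^sup>2)"
      proof (rule subgradient_increment_le_integral[where w = "\<lambda>t. w (- t)" and x = "\<lambda>t. x (- t)"
            and \<xi> = "\<lambda>t. \<xi> (- t)" and r = "\<lambda>t. r (- t)" and a = "- t" and b = "- s"])
        show "norm (x (- v) - x (- u)) \<le> integral {u..v} (\<lambda>t. r (- t))"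
          if "- t \<le> u" "u \<le> v" "v \<le> - s" for u v
          using x[of "- v" "- u"] refl[of "- u" "- v" r] that sub_int by (simp add: norm_minus_commute)
        show "(\<lambda>t. r (- t)) integrable_on {- t..- s}" "(\<lambda>t. (r (- t))\<^sup>2) integrable_on {- t..- s}"
          using ri Henstock_Kurzweil_Integration.integrable_reflect_real[of r t s]
            Henstock_Kurzweil_Integration.integrable_reflect_real[of "\<lambda>t. (r t)\<^sup>2" t s] by auto
      qed (use st sub \<xi> in auto)
      then show ?thesis
        using refl[of t s "\<lambda>t. (r t)\<^sup>2"] M_diff by simp
    qed
    ultimately show "norm (w t - w s) \<le> 1 * (norm (M t - M s) + norm (M t - M s))"
      by (simp add: abs_le_iff)
  qed simp
qed

subsection \<open>Integrability\<close>

text \<open>Integrability of the square includes its measurability, and the square root passes this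
  on to the norm. Only scalar functions built from the norm of \<open>\<xi>\<close> are integrated
  later.\<close>

lemma L2_on_norm_absolutely_integrable:
  assumes "L2_on a b f"
  shows "(\<lambda>t. (norm (f t))\<^sup>2) absolutely_integrable_on {a<..<b}"
    and "(\<lambda>t. norm (f t)) \<in> borel_measurable (lebesgue_on {a<..<b})"
proof -
  show sq: "(\<lambda>t. (norm (f t))\<^sup>2) absolutely_integrable_on {a<..<b}"
    using assms by (simp add: L2_on_def)
  then have "(\<lambda>t. (norm (f t))\<^sup>2) \<in> borel_measurable (lebesgue_on {a<..<b})"
    by (simp add: absolutely_integrable_measurable)
  then have "(\<lambda>t. sqrt ((norm (f t))\<^sup>2)) \<in> borel_measurable (lebesgue_on {a<..<b})"
    by measurable
  then show "(\<lambda>t. norm (f t)) \<in> borel_measurable (lebesgue_on {a<..<b})"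
    by simp
qed

lemma absolutely_integrable_continuous_mult:
  fixes f g :: "real \<Rightarrow> real"
  assumes "continuous_on {a..b} g" and "f absolutely_integrable_on {a..b}"
  shows "(\<lambda>t. g t * f t) absolutely_integrable_on {a..b}"
proof (rule absolutely_integrable_bounded_measurable_product_real)
  show "g \<in> borel_measurable (lebesgue_on {a..b})"
    using assms(1) by (intro continuous_imp_measurable_on_sets_lebesgue) auto
  show "bounded (g ` {a..b})"
    using assms(1) by (intro compact_imp_bounded compact_continuous_image) auto
qed (use assms(2) in auto)

lemma integrable_on_atLeast_if_bounded_integrals:
  fixes f :: "real \<Rightarrow> real"
  assumes nonneg: "\<And>t. a \<le> t \<Longrightarrow> 0 \<le> f t"
    and int: "\<And>b. a \<le> b \<Longrightarrow> f integrable_on {a..b}"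
    and bound: "\<And>b. a \<le> b \<Longrightarrow> integral {a..b} f \<le> B"
  shows "f integrable_on {a..}"
proof -
  define g where "g = (\<lambda>(k::nat) t. if t \<in> {a..a + k} then f t else 0)"
  have Int: "{a..a + real k} \<inter> {a..} = {a..a + real k}" for k by auto
  have eq: "integral {a..} (g k) = integral {a..a + k} f" for k
    unfolding g_def integral_restrict_Int Int ..
  have "f integrable_on {a..} \<and> (\<lambda>k. integral {a..} (g k)) \<longlonglongrightarrow> integral {a..} f"
  proof (rule monotone_convergence_increasing)
    show "g k integrable_on {a..}" for k
      unfolding g_def integrable_restrict_Int Int by (rule int) simp
    show "g k t \<le> g (Suc k) t" if "t \<in> {a..}" for k t
      using nonneg that by (auto simp: g_def)
    show "(\<lambda>k. g k t) \<longlonglongrightarrow> f t" if "t \<in> {a..}" for t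
    proof (rule tendsto_eventually)
      obtain n where n: "t - a \<le> real n" using real_arch_simple by blast
      show "\<forall>\<^sub>F k in sequentially. g k t = f t"
        using that n by (intro eventually_sequentiallyI[of n]) (auto simp: g_def)
    qed
    have "\<bar>integral {a..} (g k)\<bar> \<le> B" for k
      using bound[of "a + k"] integral_nonneg[OF int[of "a + k"]] nonneg unfolding eq by auto
    then show "bounded (range (\<lambda>k. integral {a..} (g k)))"
      by (auto intro!: boundedI)
  qed
  then show ?thesis ..
qed

subsection \<open>The energy of a strong solution\<close>

lemma has_real_derivative_inner_self:
  assumes "(f has_vector_derivative f') (at t)"
  shows "((\<lambda>s. f s \<bullet> f s) has_real_derivative 2 * (f t \<bullet> f')) (at t)"
  unfolding has_real_derivative_iff_has_vector_derivative
  using bounded_bilinear.has_vector_derivative[OF bounded_bilinear_inner assms assms]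
  by (simp add: inner_commute)

text \<open>
  The coefficient of \<open>\<xi> \<bullet> U\<close> cancels; this is what the factor \<open>t - \<beta> * (l + 2 - \<alpha>)\<close> in the
  energy is chosen for.
\<close>

lemma energy_derivative_identity:
  fixes X U \<xi> :: "'a::real_inner"
  shows "t * (t - \<beta> * (l + 2 - \<alpha>)) * (\<xi> \<bullet> U)
      + (l *\<^sub>R X + t *\<^sub>R (U + \<beta> *\<^sub>R \<xi>)) \<bullet> ((l + 1 - \<alpha>) *\<^sub>R U - (t - \<beta>) *\<^sub>R \<xi>)
      + l * (\<alpha> - l - 1) * (X \<bullet> U)
    = - (l * (t - \<beta>) * (\<xi> \<bullet> X)) - t * (\<alpha> - l - 1) * (U \<bullet> U) - \<beta> * t * (t - \<beta>) * (\<xi> \<bullet> \<xi>)"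
  by (simp add: inner_add_left inner_add_right inner_diff_left inner_diff_right
      inner_commute[of U \<xi>] inner_commute[of \<xi> X] algebra_simps)

section \<open>The solution, the selection \<open>\<xi>\<close> and the gap \<open>w\<close>\<close>

locale din_avd_solution =
  fixes \<phi> :: "'h::real_inner \<Rightarrow> ereal" and \<alpha> \<beta> t0 :: real
    and x y \<xi> :: "real \<Rightarrow> 'h" and xs :: 'h
  assumes proper: "proper_function \<phi>"
    and alpha: "3 \<le> \<alpha>" and beta: "0 < \<beta>" and t0: "0 < t0"
    and solution: "global_strong_solution \<phi> \<alpha> \<beta> t0 x y"
    and subgradient: "\<And>t. t0 < t \<Longrightarrow> \<xi> t \<in> subdifferential \<phi> (x t)"
    and selection: "AE t in lebesgue. t0 < t \<longrightarrow>
      vector_derivative x (at t) + \<beta> *\<^sub>R \<xi> t - (1 / \<beta> - \<alpha> / t) *\<^sub>R x t + (1 / \<beta>) *\<^sub>R y t = 0"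
    and L2: "\<And>T. t0 < T \<Longrightarrow> L2_on t0 T \<xi>"
    and minimizer: "xs \<in> argmin_set \<phi>"
begin

definition w :: "real \<Rightarrow> real" where
  "w t = real_of_ereal (\<phi> (x t) - min_value \<phi>)"

definition v :: "real \<Rightarrow> 'h" where
  "v t = u_dot \<alpha> \<beta> x y t"

lemma min_value_eq: "min_value \<phi> = \<phi> xs"
  using minimizer unfolding min_value_def argmin_set_def
  by (intro antisym INF_lower INF_greatest) auto

lemma min_finite: "\<bar>\<phi> xs\<bar> \<noteq> \<infinity>"
proof -
  obtain z where "\<phi> z < \<infinity>"
    using proper by (auto simp: proper_function_def effective_domain_def)
  then have "\<phi> xs < \<infinity>"
    using minimizer by (auto simp: argmin_set_def intro: le_less_trans)
  then show ?thesis using proper by (auto simp: proper_function_def)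
qed

text \<open>The selection is a subgradient at every \<open>t > t0\<close>, not just almost
  everywhere; testing its inequality at the minimizer \<open>xs\<close> excludes the value
  \<open>\<infinity>\<close>. The coercion in \<open>w\<close> is thus harmless.\<close>

lemma phi_finite: "\<bar>\<phi> (x t)\<bar> \<noteq> \<infinity>" if "t0 < t"
proof -
  have "\<phi> (x t) + ereal (\<xi> t \<bullet> (xs - x t)) \<le> \<phi> xs"
    using subgradient[OF that] by (auto simp: subdifferential_def)
  then show ?thesis
    using proper min_finite by (auto simp: proper_function_def)
qed

lemma phi_diff_eq: "\<phi> (x t) - min_value \<phi> = ereal (w t)" if "t0 < t"
  using phi_finite[OF that] min_finite unfolding w_def min_value_eq
  by (cases "\<phi> (x t)"; cases "\<phi> xs") auto

lemma w_nonneg: "0 \<le> w t" if "t0 < t"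
proof -
  have "\<phi> xs \<le> \<phi> (x t)" using minimizer by (auto simp: argmin_set_def)
  then show ?thesis
    using phi_finite[OF that] min_finite unfolding w_def min_value_eq
    by (cases "\<phi> (x t)"; cases "\<phi> xs") auto
qed

lemma w_le_subgradient: "w t - w s \<le> \<xi> t \<bullet> (x t - x s)" if "t0 < s" "t0 < t"
proof -
  have "\<phi> (x t) + ereal (\<xi> t \<bullet> (x s - x t)) \<le> \<phi> (x s)"
    using subgradient[OF that(2)] by (auto simp: subdifferential_def)
  then show ?thesis
    using phi_finite[OF that(1)] phi_finite[OF that(2)] min_finite unfolding w_def min_value_eq
    by (cases "\<phi> (x t)"; cases "\<phi> xs"; cases "\<phi> (x s)") (auto simp: inner_diff_right)
qed

lemma w_le_minimizer: "w t \<le> \<xi> t \<bullet> (x t - xs)" if "t0 < t"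
proof -
  have "\<phi> (x t) + ereal (\<xi> t \<bullet> (xs - x t)) \<le> \<phi> xs"
    using subgradient[OF that] by (auto simp: subdifferential_def)
  then show ?thesis
    using phi_finite[OF that] min_finite unfolding w_def min_value_eq
    by (cases "\<phi> (x t)"; cases "\<phi> xs") (auto simp: inner_diff_right)
qed

section \<open>Regularity of \<open>x\<close>, \<open>v\<close>, \<open>\<xi>\<close> and
  \<open>w\<close> to the right of \<open>t0\<close>\<close>

lemma abs_continuous_x: "abs_continuous_on {a..b} x"
  and abs_continuous_y: "abs_continuous_on {a..b} y" if "t0 < a"
proof -
  have "t0 < max b (t0 + 1)" "{a..b} \<subseteq> {t0<..max b (t0 + 1)}" using that by auto
  then show "abs_continuous_on {a..b} x" "abs_continuous_on {a..b} y"
    using solution compact_Icc unfolding global_strong_solution_def by blast+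
qed

lemma abs_continuous_v: "abs_continuous_on {a..b} v" if "t0 < a"
proof -
  have "abs_continuous_on {a..b} (\<lambda>t. 1 / \<beta> - \<alpha> / t)"
    using that t0
    by (intro abs_continuous_on_C1[where f' = "\<lambda>t. \<alpha> / t\<^sup>2"])
      (auto intro!: derivative_eq_intros continuous_intros simp: power2_eq_square)
  then have "abs_continuous_on {a..b} (\<lambda>t. (1 / \<beta> - \<alpha> / t) *\<^sub>R x t)"
    by (rule abs_continuous_on_scaleR[OF compact_Icc _ abs_continuous_x[OF that]])
  moreover have "abs_continuous_on {a..b} (\<lambda>t. (1 / \<beta>) *\<^sub>R y t)"
    by (rule abs_continuous_on_scaleR[OF compact_Icc abs_continuous_on_const abs_continuous_y[OF that]])
  ultimately show ?thesis
    unfolding v_def u_dot_def by (rule abs_continuous_on_diff)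
qed

lemma continuous_x: "continuous_on {t0..b} x"
proof -
  have "continuous_on {t0..max b (t0 + 1)} x"
    using solution unfolding global_strong_solution_def by (auto dest: spec[of _ "max b (t0 + 1)"])
  then show ?thesis by (rule continuous_on_subset) auto
qed

text \<open>The exceptional set may depend on \<open>T\<close>; countably many values of
  \<open>T\<close> exhaust the half-line.\<close>

lemma AE_lebesgue_all_T:
  assumes "\<And>T. t0 < T \<Longrightarrow> AE t in lebesgue. t \<in> {t0<..T} \<longrightarrow> P t"
  shows "AE t in lebesgue. t0 < t \<longrightarrow> P t"
proof -
  have "AE t in lebesgue. \<forall>n::nat. t \<in> {t0<..t0 + (real n + 1)} \<longrightarrow> P t"
    unfolding AE_all_countable by (intro allI assms) simp
  then show ?thesis
  proof (rule eventually_mono, intro impI)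
    fix t assume P: "\<forall>n::nat. t \<in> {t0<..t0 + (real n + 1)} \<longrightarrow> P t" and "t0 < t"
    obtain n where "t - t0 \<le> real n" using real_arch_simple by blast
    then show "P t" using P[rule_format, of n] \<open>t0 < t\<close> by simp
  qed
qed

text \<open>Where \<open>x\<close> has no derivative, \<open>vector_derivative\<close> is an
  unspecified value, so \<open>selection\<close> alone does not yield a derivative. Its existence
  comes from the strong solution, its value from the selection.\<close>

lemma AE_derivatives:
  "AE t in lebesgue. t0 < t \<longrightarrow> vector_derivative x (at t) + \<beta> *\<^sub>R \<xi> t = v t
    \<and> (x has_vector_derivative v t - \<beta> *\<^sub>R \<xi> t) (at t)
    \<and> (v has_vector_derivative - (\<alpha> / t) *\<^sub>R (v t - \<beta> *\<^sub>R \<xi> t) - \<xi> t) (at t)"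
proof -
  have x_AE: "AE t in lebesgue. t \<in> {t0<..T} \<longrightarrow> (\<exists>x'. (x has_vector_derivative x') (at t))"
    and y_AE: "AE t in lebesgue. t \<in> {t0<..T} \<longrightarrow> (\<exists>y'. (y has_vector_derivative y') (at t) \<and>
      y' - (1 / \<beta> - \<alpha> / t + \<alpha> * \<beta> / t\<^sup>2) *\<^sub>R x t + (1 / \<beta>) *\<^sub>R y t = 0)" if "t0 < T" for T
  proof -
    note sol = solution[unfolded global_strong_solution_def, rule_format, OF that]
    have "AE t in lebesgue. t \<in> {t0<..T} \<longrightarrow> (\<exists>x'. (x has_vector_derivative x') (at t) \<and>
        (\<exists>g\<in>subdifferential \<phi> (x t). x' + \<beta> *\<^sub>R g - (1 / \<beta> - \<alpha> / t) *\<^sub>R x t + (1 / \<beta>) *\<^sub>R y t = 0))"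
      using sol by (elim conjE)
    then show "AE t in lebesgue. t \<in> {t0<..T} \<longrightarrow> (\<exists>x'. (x has_vector_derivative x') (at t))"
      by (rule eventually_mono) blast
    show "AE t in lebesgue. t \<in> {t0<..T} \<longrightarrow> (\<exists>y'. (y has_vector_derivative y') (at t) \<and>
      y' - (1 / \<beta> - \<alpha> / t + \<alpha> * \<beta> / t\<^sup>2) *\<^sub>R x t + (1 / \<beta>) *\<^sub>R y t = 0)"
      using sol by (elim conjE)
  qed
  have "AE t in lebesgue. t0 < t \<longrightarrow> (\<exists>x'. (x has_vector_derivative x') (at t))"
    by (rule AE_lebesgue_all_T) (rule x_AE)
  moreover have "AE t in lebesgue. t0 < t \<longrightarrow> (\<exists>y'. (y has_vector_derivative y') (at t) \<and>
      y' - (1 / \<beta> - \<alpha> / t + \<alpha> * \<beta> / t\<^sup>2) *\<^sub>R x t + (1 / \<beta>) *\<^sub>R y t = 0)"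
    by (rule AE_lebesgue_all_T) (rule y_AE)
  ultimately show ?thesis using selection
  proof eventually_elim
    case (elim t)
    show ?case
    proof (intro impI)
      assume "t0 < t"
      then have "t > 0" using t0 by simp
      have vd: "vector_derivative x (at t) + \<beta> *\<^sub>R \<xi> t = v t"
        using elim(3) \<open>t0 < t\<close> by (simp add: v_def u_dot_def algebra_simps)
      obtain x' where "(x has_vector_derivative x') (at t)" using elim(1) \<open>t0 < t\<close> by blast
      then have x': "(x has_vector_derivative v t - \<beta> *\<^sub>R \<xi> t) (at t)"
        using vd vector_derivative_at by (metis add_diff_cancel_right')
      obtain y' where y': "(y has_vector_derivative y') (at t)"
        "y' - (1 / \<beta> - \<alpha> / t + \<alpha> * \<beta> / t\<^sup>2) *\<^sub>R x t + (1 / \<beta>) *\<^sub>R y t = 0"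
        using elim(2) \<open>t0 < t\<close> by blast
      have "((\<lambda>t. 1 / \<beta> - \<alpha> / t) has_real_derivative \<alpha> / t\<^sup>2) (at t)"
        using \<open>t > 0\<close> by (auto intro!: derivative_eq_intros simp: power2_eq_square)
      then have "((\<lambda>t. (1 / \<beta> - \<alpha> / t) *\<^sub>R x t - (1 / \<beta>) *\<^sub>R y t) has_vector_derivative
          ((1 / \<beta> - \<alpha> / t) *\<^sub>R (v t - \<beta> *\<^sub>R \<xi> t) + (\<alpha> / t\<^sup>2) *\<^sub>R x t) - (1 / \<beta>) *\<^sub>R y') (at t)"
        by (intro has_vector_derivative_diff has_vector_derivative_scaleR x')
          (auto intro!: derivative_eq_intros y')
      moreover have "((1 / \<beta> - \<alpha> / t) *\<^sub>R (v t - \<beta> *\<^sub>R \<xi> t) + (\<alpha> / t\<^sup>2) *\<^sub>R x t) - (1 / \<beta>) *\<^sub>R y'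
          = - (\<alpha> / t) *\<^sub>R (v t - \<beta> *\<^sub>R \<xi> t) - \<xi> t"
      proof -
        \<comment> \<open>The term \<open>\<alpha> * \<beta> / t\<^sup>2\<close> of the second
          equation cancels the derivative of the coefficient \<open>- (\<alpha> / t)\<close>, so no
          multiple of \<open>x t\<close> survives in the derivative of \<open>v\<close>.\<close>
        have "y' = v t + (\<alpha> * \<beta> / t\<^sup>2) *\<^sub>R x t"
          using y'(2) by (simp add: v_def u_dot_def algebra_simps)
        then show ?thesis
          using beta by (simp add: algebra_simps)
      qed
      ultimately show "vector_derivative x (at t) + \<beta> *\<^sub>R \<xi> t = v t
        \<and> (x has_vector_derivative v t - \<beta> *\<^sub>R \<xi> t) (at t)
        \<and> (v has_vector_derivative - (\<alpha> / t) *\<^sub>R (v t - \<beta> *\<^sub>R \<xi> t) - \<xi> t) (at t)"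
        using vd x' unfolding v_def u_dot_def by simp
    qed
  qed
qed

lemma derivatives_obtain:
  obtains N where "negligible N"
    "\<And>t. \<lbrakk>t0 < t; t \<notin> N\<rbrakk> \<Longrightarrow> (x has_vector_derivative v t - \<beta> *\<^sub>R \<xi> t) (at t)"
    "\<And>t. \<lbrakk>t0 < t; t \<notin> N\<rbrakk> \<Longrightarrow> (v has_vector_derivative - (\<alpha> / t) *\<^sub>R (v t - \<beta> *\<^sub>R \<xi> t) - \<xi> t) (at t)"
proof -
  obtain N where "N \<in> null_sets lebesgue"
    and "\<And>t. t \<notin> N \<Longrightarrow> t0 < t \<longrightarrow> vector_derivative x (at t) + \<beta> *\<^sub>R \<xi> t = v t
      \<and> (x has_vector_derivative v t - \<beta> *\<^sub>R \<xi> t) (at t)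
      \<and> (v has_vector_derivative - (\<alpha> / t) *\<^sub>R (v t - \<beta> *\<^sub>R \<xi> t) - \<xi> t) (at t)"
    using AE_E3[OF AE_derivatives] by auto
  then show ?thesis
    by (intro that[of N]) (auto simp: negligible_iff_null_sets)
qed

lemma xi_sq_integrable: "(\<lambda>t. (norm (\<xi> t))\<^sup>2) absolutely_integrable_on {a..b}" if "t0 < a"
proof -
  have "{a..b} \<subseteq> {t0<..<max (t0 + 1) (b + 1)}" "t0 < max (t0 + 1) (b + 1)" using that by auto
  then show ?thesis
    using L2_on_norm_absolutely_integrable(1)[OF L2[of "max (t0 + 1) (b + 1)"]]
    by (auto intro: absolutely_integrable_on_subinterval)
qed

lemma xi_measurable: "(\<lambda>t. norm (\<xi> t)) \<in> borel_measurable (lebesgue_on {a..b})" if "t0 < a"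
proof -
  have "{a..b} \<subseteq> {t0<..<max (t0 + 1) (b + 1)}" "t0 < max (t0 + 1) (b + 1)" using that by auto
  then show ?thesis
    using L2_on_norm_absolutely_integrable(2)[OF L2[of "max (t0 + 1) (b + 1)"]]
    by (auto intro: measurable_restrict_mono)
qed

lemma xi_integrable: "(\<lambda>t. norm (\<xi> t)) absolutely_integrable_on {a..b}" if "t0 < a"
proof (rule measurable_bounded_by_integrable_imp_absolutely_integrable[OF xi_measurable[OF that]])
  show "(\<lambda>t. 1 + (norm (\<xi> t))\<^sup>2) integrable_on {a..b}"
    using set_lebesgue_integral_eq_integral(1)[OF xi_sq_integrable[OF that]]
    by (intro integrable_add) auto
  show "norm (norm (\<xi> t)) \<le> 1 + (norm (\<xi> t))\<^sup>2" for t
    using zero_le_power2[of "norm (\<xi> t) - 1"] zero_le_power2[of "norm (\<xi> t)"]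
    by (simp add: power2_diff) (use norm_ge_zero[of "\<xi> t"] in linarith)
qed auto

lemma abs_continuous_w: "abs_continuous_on {a..b} w" if "t0 < a"
proof -
  \<comment> \<open>One function has to dominate both the subgradient and the velocity
    \<open>v t - \<beta> *\<^sub>R \<xi> t\<close>; the factor \<open>\<beta> + 1\<close> covers
    both.\<close>
  define r where "r = (\<lambda>t. norm (v t) + (\<beta> + 1) * norm (\<xi> t))"
  have v: "continuous_on {a..b} v"
    using abs_continuous_v[OF that] by (rule abs_continuous_on_imp_continuous_on)
  have "(\<lambda>t. norm (v t)) \<in> borel_measurable (lebesgue_on {a..b})"
    by (intro continuous_imp_measurable_on_sets_lebesgue continuous_on_norm v) auto
  then have rm: "r \<in> borel_measurable (lebesgue_on {a..b})"
    unfolding r_def using xi_measurable[OF that] by measurable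
  have "(\<lambda>t. 2 * (norm (v t))\<^sup>2 + 2 * (\<beta> + 1)\<^sup>2 * (norm (\<xi> t))\<^sup>2) integrable_on {a..b}"
    by (intro integrable_add integrable_on_mult_right
        set_lebesgue_integral_eq_integral(1)[OF xi_sq_integrable[OF that]]
        integrable_continuous_interval[of _ _ "\<lambda>t. (norm (v t))\<^sup>2"] continuous_intros v)
  moreover have "norm ((r t)\<^sup>2) \<le> 2 * (norm (v t))\<^sup>2 + 2 * (\<beta> + 1)\<^sup>2 * (norm (\<xi> t))\<^sup>2" for t
    using zero_le_power2[of "norm (v t) - (\<beta> + 1) * norm (\<xi> t)"]
    unfolding r_def real_norm_def abs_power2 by (simp add: power2_eq_square algebra_simps)
  ultimately have r2: "(\<lambda>t. (r t)\<^sup>2) absolutely_integrable_on {a..b}"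
    using rm by (intro measurable_bounded_by_integrable_imp_absolutely_integrable) auto
  have r: "r absolutely_integrable_on {a..b}"
    unfolding r_def
  proof (rule set_integral_add)
    show "(\<lambda>t. norm (v t)) absolutely_integrable_on {a..b}"
      by (intro absolutely_integrable_continuous_real continuous_on_norm v)
    show "(\<lambda>t. (\<beta> + 1) * norm (\<xi> t)) absolutely_integrable_on {a..b}"
      by (intro set_integrable_mult_right xi_integrable that)
  qed
  obtain N where N: "negligible N"
    "\<And>t. \<lbrakk>t0 < t; t \<notin> N\<rbrakk> \<Longrightarrow> (x has_vector_derivative v t - \<beta> *\<^sub>R \<xi> t) (at t)"
    using derivatives_obtain by metis
  have ge: "norm (\<xi> t) \<le> r t" "norm (v t - \<beta> *\<^sub>R \<xi> t) \<le> r t" for t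
    using norm_triangle_ineq4[of "v t" "\<beta> *\<^sub>R \<xi> t"] beta
    by (auto simp: r_def algebra_simps intro: order_trans)
  show ?thesis
  proof (rule subgradient_abs_continuous[where x = x and \<xi> = \<xi> and r = r])
    fix s t assume st: "a \<le> s" "s \<le> t" "t \<le> b"
    show "norm (x t - x s) \<le> integral {s..t} r"
    proof (rule norm_abs_continuous_on_increment_le_integral[OF st(2) _ N(1)])
      show "abs_continuous_on {s..t} x" using that st by (intro abs_continuous_x) auto
      show "r absolutely_integrable_on {s..t}"
        using r st by (auto intro: absolutely_integrable_on_subinterval)
      fix \<tau> assume "s < \<tau>" "\<tau> < t" "\<tau> \<notin> N"
      then show "\<exists>D. (x has_vector_derivative D) (at \<tau>) \<and> norm D \<le> r \<tau>"
        using N(2)[of \<tau>] that st ge by auto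
    qed
  qed (use that ge w_le_subgradient r r2 in \<open>auto intro: set_lebesgue_integral_eq_integral(1)\<close>)
qed

section \<open>The energy, its integrating factor and the decay estimate\<close>

definition E :: "real \<Rightarrow> real \<Rightarrow> real" where
  "E l t = energy \<phi> \<alpha> \<beta> l xs x y t"

lemma E_eq: "E l t = t * (t - \<beta> * (l + 2 - \<alpha>)) * w t
    + 1 / 2 * (norm (l *\<^sub>R (x t - xs) + t *\<^sub>R v t))\<^sup>2 + l * (\<alpha> - l - 1) * (1 / 2) * (norm (x t - xs))\<^sup>2"
  by (simp add: E_def energy_def w_def v_def)

text \<open>The integrating factor: \<open>\<beta> / (t * (t - \<beta>))\<close> has the
  antiderivative \<open>ln ((t - \<beta>) / t)\<close>, and \<open>m\<close> is the exponential of
  \<open>- (\<alpha> - 2)\<close> times it. It tends to 1, so passing between \<open>E\<close> and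
  \<open>G\<close> does not change limits.\<close>

definition m :: "real \<Rightarrow> real" where
  "m t = (t / (t - \<beta>)) powr (\<alpha> - 2)"

definition G :: "real \<Rightarrow> real \<Rightarrow> real" where
  "G l t = m t * E l t"

lemma m_ge_1: "1 \<le> m t" if "\<beta> < t"
  unfolding m_def using that beta alpha by (intro ge_one_powr_ge_zero) auto

lemma m_derivative:
  "(m has_real_derivative - ((\<alpha> - 2) * \<beta> / (t * (t - \<beta>))) * m t) (at t)" if "\<beta> < t"
proof -
  have pos: "0 < t" "0 < t - \<beta>" using that beta by auto
  have "((\<lambda>t. t / (t - \<beta>)) has_real_derivative - (\<beta> / (t - \<beta>)\<^sup>2)) (at t)"
    using pos by (auto intro!: derivative_eq_intros simp: power2_eq_square divide_simps)
  then have "(m has_real_derivative (\<alpha> - 2) * (t / (t - \<beta>)) powr ((\<alpha> - 2) - of_nat 1)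
      * - (\<beta> / (t - \<beta>)\<^sup>2)) (at t)"
    unfolding m_def using pos by (intro DERIV_fun_powr) auto
  also have "(t / (t - \<beta>)) powr ((\<alpha> - 2) - of_nat 1) = m t / (t / (t - \<beta>))"
    using pos by (subst powr_diff) (auto simp: m_def)
  also have "(\<alpha> - 2) * (m t / (t / (t - \<beta>))) * - (\<beta> / (t - \<beta>)\<^sup>2)
      = - ((\<alpha> - 2) * \<beta> / (t * (t - \<beta>))) * m t"
    using pos by (simp add: power2_eq_square)
  finally show ?thesis .
qed

lemma abs_continuous_m: "abs_continuous_on {a..b} m" if "\<beta> < a"
proof (rule abs_continuous_on_C1)
  show "(m has_real_derivative - ((\<alpha> - 2) * \<beta> / (t * (t - \<beta>))) * m t) (at t)" if "t \<in> {a..b}" for t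
    using that \<open>\<beta> < a\<close> by (intro m_derivative) auto
  then have "continuous_on {a..b} m"
    by (intro DERIV_continuous_on) (auto intro: has_field_derivative_at_within)
  then show "continuous_on {a..b} (\<lambda>t. - ((\<alpha> - 2) * \<beta> / (t * (t - \<beta>))) * m t)"
    using \<open>\<beta> < a\<close> beta by (intro continuous_intros) auto
qed

lemma abs_continuous_E: "abs_continuous_on {a..b} (E l)" if "t0 < a"
proof -
  note intros = abs_continuous_on_add abs_continuous_on_diff abs_continuous_on_const
    abs_continuous_on_ident abs_continuous_on_mult[OF compact_Icc]
    abs_continuous_on_scaleR[OF compact_Icc] abs_continuous_on_inner[OF compact_Icc]
    abs_continuous_x[OF that] abs_continuous_v[OF that] abs_continuous_w[OF that]
  have "abs_continuous_on {a..b} (\<lambda>t. t * (t - \<beta> * (l + 2 - \<alpha>)) * w t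
      + 1 / 2 * ((l *\<^sub>R (x t - xs) + t *\<^sub>R v t) \<bullet> (l *\<^sub>R (x t - xs) + t *\<^sub>R v t))
      + l * (\<alpha> - l - 1) * (1 / 2) * ((x t - xs) \<bullet> (x t - xs)))"
    by (intro intros)
  then show ?thesis
    by (simp add: E_eq[abs_def] power2_norm_eq_inner)
qed

text \<open>The bound \<open>l \<le> \<alpha> - 1\<close> acts twice: it gives
  \<open>l + 2 - \<alpha> \<le> 1\<close>, so the weight of \<open>w t\<close> is at least
  \<open>t * (t - \<beta>)\<close>, and it makes the last term of the energy nonnegative.\<close>

lemma E_ge:
  assumes "t0 < t" "\<beta> < t" "l \<in> {2..\<alpha> - 1}"
  shows "t * (t - \<beta>) * w t + 1 / 2 * (norm (l *\<^sub>R (x t - xs) + t *\<^sub>R v t))\<^sup>2 \<le> E l t"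
proof -
  have "\<beta> * (l + 2 - \<alpha>) \<le> \<beta> * 1"
    using assms beta by (intro mult_left_mono) auto
  then have "t * (t - \<beta>) * w t \<le> t * (t - \<beta> * (l + 2 - \<alpha>)) * w t"
    using assms t0 w_nonneg[of t] by (intro mult_right_mono mult_left_mono) auto
  moreover have "0 \<le> l * (\<alpha> - l - 1) * (1 / 2) * (norm (x t - xs))\<^sup>2"
    using assms by auto
  ultimately show ?thesis unfolding E_eq by linarith
qed

lemma E_nonneg: "0 \<le> E l t" if "t0 < t" "\<beta> < t" "l \<in> {2..\<alpha> - 1}"
proof -
  have "0 \<le> t * (t - \<beta>) * w t" using that t0 w_nonneg[of t] by simp
  then show ?thesis
    using E_ge[OF that] zero_le_power2[of "norm (l *\<^sub>R (x t - xs) + t *\<^sub>R v t)"] by linarith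
qed

text \<open>The touching function \<open>q\<close> is \<open>G l\<close> with \<open>w\<close>
  replaced by its minorant from the subgradient \<open>\<xi> \<tau>\<close>. All other ingredients
  are differentiable at almost every \<open>\<tau>\<close>, so the derivative of \<open>q\<close>
  can be computed there.\<close>

lemma energy_decay:
  assumes s: "t0 < s" "\<beta> < s" "s \<le> t" and l: "l \<in> {2..\<alpha> - 1}"
  shows "G l t - G l s \<le> integral {s..t} (\<lambda>\<tau>. - (\<beta> * \<tau> * (\<tau> - \<beta>) * (norm (\<xi> \<tau>))\<^sup>2))"
proof -
  obtain N where N: "negligible N"
    "\<And>t. \<lbrakk>t0 < t; t \<notin> N\<rbrakk> \<Longrightarrow> (x has_vector_derivative v t - \<beta> *\<^sub>R \<xi> t) (at t)"
    "\<And>t. \<lbrakk>t0 < t; t \<notin> N\<rbrakk> \<Longrightarrow> (v has_vector_derivative - (\<alpha> / t) *\<^sub>R (v t - \<beta> *\<^sub>R \<xi> t) - \<xi> t) (at t)"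
    using derivatives_obtain by metis
  show ?thesis
  proof (rule abs_continuous_on_increment_le_integral[OF s(3) _ N(1)])
    show "abs_continuous_on {s..t} (G l)"
      unfolding G_def[abs_def]
      using abs_continuous_m[OF s(2)] abs_continuous_E[OF s(1)] by (intro abs_continuous_on_mult) auto
    have "(\<lambda>\<tau>. - (\<beta> * \<tau> * (\<tau> - \<beta>)) * (norm (\<xi> \<tau>))\<^sup>2) absolutely_integrable_on {s..t}"
      by (intro absolutely_integrable_continuous_mult xi_sq_integrable s continuous_intros)
    then show "(\<lambda>\<tau>. - (\<beta> * \<tau> * (\<tau> - \<beta>) * (norm (\<xi> \<tau>))\<^sup>2)) absolutely_integrable_on {s..t}"
      by simp
    fix \<tau> assume \<tau>: "s < \<tau>" "\<tau> < t" "\<tau> \<notin> N"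
    then have pos: "t0 < \<tau>" "\<beta> < \<tau>" "0 < \<tau>" "0 < \<tau> - \<beta>" using s t0 by auto
    define X where "X = x \<tau> - xs"
    define U where "U = v \<tau> - \<beta> *\<^sub>R \<xi> \<tau>"
    define z where "z = (\<lambda>s. l *\<^sub>R (x s - xs) + s *\<^sub>R v s)"
    define z' where "z' = (l + 1 - \<alpha>) *\<^sub>R U - (\<tau> - \<beta>) *\<^sub>R \<xi> \<tau>"
    define c where "c = (\<lambda>s. s * (s - \<beta> * (l + 2 - \<alpha>)))"
    define q where "q = (\<lambda>s. m s * (c s * (w \<tau> + \<xi> \<tau> \<bullet> (x s - x \<tau>)) + 1 / 2 * (z s \<bullet> z s)
        + l * (\<alpha> - l - 1) * (1 / 2) * ((x s - xs) \<bullet> (x s - xs))))"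
    define R where "R = (2 * \<tau> - \<beta> * (l + 2 - \<alpha>)) * w \<tau> + c \<tau> * (\<xi> \<tau> \<bullet> U) + z \<tau> \<bullet> z'
        + l * (\<alpha> - l - 1) * (X \<bullet> U)"
    have x': "(x has_vector_derivative U) (at \<tau>)"
      using N(2)[OF pos(1) \<tau>(3)] by (simp add: U_def)
    have v': "(v has_vector_derivative - (\<alpha> / \<tau>) *\<^sub>R U - \<xi> \<tau>) (at \<tau>)"
      using N(3)[OF pos(1) \<tau>(3)] by (simp add: U_def)
    have X': "((\<lambda>s. x s - xs) has_vector_derivative U) (at \<tau>)"
      using has_vector_derivative_diff[OF x' has_vector_derivative_const[of xs]] by simp
    have "(z has_vector_derivative l *\<^sub>R U + (\<tau> *\<^sub>R (- (\<alpha> / \<tau>) *\<^sub>R U - \<xi> \<tau>) + 1 *\<^sub>R v \<tau>)) (at \<tau>)"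
      unfolding z_def
      by (intro has_vector_derivative_add has_vector_derivative_scaleR v' X'
          bounded_linear.has_vector_derivative[OF bounded_linear_scaleR_right]) (rule DERIV_ident)
    \<comment> \<open>The weight \<open>\<tau>\<close> cancels the denominator of the damping
      coefficient, and \<open>v \<tau>\<close> is rewritten as
      \<open>U + \<beta> *\<^sub>R \<xi> \<tau>\<close>.\<close>
    moreover have "l *\<^sub>R U + (\<tau> *\<^sub>R (- (\<alpha> / \<tau>) *\<^sub>R U - \<xi> \<tau>) + 1 *\<^sub>R v \<tau>) = z'"
      using pos by (simp add: z'_def U_def algebra_simps)
    ultimately have z': "(z has_vector_derivative z') (at \<tau>)" by simp
    have tangent': "((\<lambda>s. w \<tau> + \<xi> \<tau> \<bullet> (x s - x \<tau>)) has_real_derivative \<xi> \<tau> \<bullet> U) (at \<tau>)"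
    proof -
      have "((\<lambda>s. \<xi> \<tau> \<bullet> (x s - x \<tau>)) has_vector_derivative \<xi> \<tau> \<bullet> U) (at \<tau>)"
        using has_vector_derivative_diff[OF x' has_vector_derivative_const[of "x \<tau>"]]
        by (intro bounded_linear.has_vector_derivative[OF bounded_linear_inner_right]) simp
      then show ?thesis
        unfolding has_real_derivative_iff_has_vector_derivative[symmetric]
        by (auto intro!: derivative_eq_intros)
    qed
    have c': "(c has_real_derivative 2 * \<tau> - \<beta> * (l + 2 - \<alpha>)) (at \<tau>)"
      unfolding c_def by (auto intro!: derivative_eq_intros simp: algebra_simps)
    have energy': "((\<lambda>s. c s * (w \<tau> + \<xi> \<tau> \<bullet> (x s - x \<tau>)) + 1 / 2 * (z s \<bullet> z s)
        + l * (\<alpha> - l - 1) * (1 / 2) * ((x s - xs) \<bullet> (x s - xs))) has_real_derivative R) (at \<tau>)"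
      by (rule DERIV_cong[OF DERIV_add[OF DERIV_add[OF DERIV_mult[OF c' tangent']
              DERIV_cmult[OF has_real_derivative_inner_self[OF z']]]
            DERIV_cmult[OF has_real_derivative_inner_self[OF X']]]])
        (simp add: R_def X_def field_simps)
    have E\<tau>: "c \<tau> * (w \<tau> + \<xi> \<tau> \<bullet> (x \<tau> - x \<tau>)) + 1 / 2 * (z \<tau> \<bullet> z \<tau>)
        + l * (\<alpha> - l - 1) * (1 / 2) * ((x \<tau> - xs) \<bullet> (x \<tau> - xs)) = E l \<tau>"
      by (simp add: E_eq c_def z_def power2_norm_eq_inner)
    define D where "D = - ((\<alpha> - 2) * \<beta> / (\<tau> * (\<tau> - \<beta>))) * m \<tau> * E l \<tau> + R * m \<tau>"
    have "(q has_real_derivative D) (at \<tau>)"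
      using DERIV_mult[OF m_derivative[OF pos(2)] energy'] unfolding q_def D_def E\<tau> .
    moreover have "D \<le> - (\<beta> * \<tau> * (\<tau> - \<beta>) * (norm (\<xi> \<tau>))\<^sup>2)"
    proof -
      define K where "K = \<beta> * \<tau> * (\<tau> - \<beta>) * (norm (\<xi> \<tau>))\<^sup>2"
      have "0 \<le> K" using pos beta by (simp add: K_def)
      have "v \<tau> = U + \<beta> *\<^sub>R \<xi> \<tau>" by (simp add: U_def)
      then have "R = (2 * \<tau> - \<beta> * (l + 2 - \<alpha>)) * w \<tau> - l * (\<tau> - \<beta>) * (\<xi> \<tau> \<bullet> X)
          - \<tau> * (\<alpha> - l - 1) * (U \<bullet> U) - K"
        using energy_derivative_identity[of \<tau> \<beta> l \<alpha> "\<xi> \<tau>" U X]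
        by (simp add: R_def c_def z_def z'_def X_def[symmetric] K_def power2_norm_eq_inner)
      moreover have "0 \<le> \<tau> * (\<alpha> - l - 1) * (U \<bullet> U)" using pos l by simp
      moreover have "l * (\<tau> - \<beta>) * w \<tau> \<le> l * (\<tau> - \<beta>) * (\<xi> \<tau> \<bullet> X)"
        using w_le_minimizer[OF pos(1)] pos l unfolding X_def by (intro mult_left_mono) auto
      ultimately have "R \<le> (2 * \<tau> - \<beta> * (l + 2 - \<alpha>)) * w \<tau> - l * (\<tau> - \<beta>) * w \<tau> - K"
        by linarith
      also have "\<dots> = (\<alpha> - 2) * \<beta> * w \<tau> - (l - 2) * (\<tau> * w \<tau>) - K"
        by (simp add: algebra_simps)
      also have "\<dots> \<le> (\<alpha> - 2) * \<beta> * w \<tau> - K"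
        using l pos w_nonneg[OF pos(1)] by simp
      finally have R: "R \<le> (\<alpha> - 2) * \<beta> * w \<tau> - K" .
      \<comment> \<open>The leftover multiple of \<open>w \<tau>\<close> is traded for the multiple
        of the energy that the derivative of \<open>m\<close> subtracts.\<close>
      have "\<tau> * (\<tau> - \<beta>) * w \<tau> \<le> E l \<tau>"
        using E_ge[OF pos(1,2) l] zero_le_power2[of "norm (l *\<^sub>R (x \<tau> - xs) + \<tau> *\<^sub>R v \<tau>)"] by linarith
      then have "w \<tau> \<le> E l \<tau> / (\<tau> * (\<tau> - \<beta>))"
        using pos by (simp add: le_divide_eq mult.commute)
      then have "(\<alpha> - 2) * \<beta> * w \<tau> \<le> (\<alpha> - 2) * \<beta> * (E l \<tau> / (\<tau> * (\<tau> - \<beta>)))"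
        using alpha beta by (intro mult_left_mono) auto
      with R have "R - (\<alpha> - 2) * \<beta> / (\<tau> * (\<tau> - \<beta>)) * E l \<tau> \<le> - K" by simp
      then have "m \<tau> * (R - (\<alpha> - 2) * \<beta> / (\<tau> * (\<tau> - \<beta>)) * E l \<tau>) \<le> m \<tau> * (- K)"
        using m_ge_1[OF pos(2)] by (intro mult_left_mono) auto
      moreover have "m \<tau> * (R - (\<alpha> - 2) * \<beta> / (\<tau> * (\<tau> - \<beta>)) * E l \<tau>) = D"
        by (simp add: D_def algebra_simps)
      moreover have "1 * K \<le> m \<tau> * K"
        using m_ge_1[OF pos(2)] \<open>0 \<le> K\<close> by (intro mult_right_mono)
      ultimately show ?thesis by (simp add: K_def)
    qed
    moreover have "q \<tau> = G l \<tau>" unfolding q_def E\<tau> G_def ..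
    moreover have "q s' \<le> G l s'" if s': "s' \<in> {s..<\<tau>}" for s'
    proof -
      have pos': "t0 < s'" "\<beta> < s'" "0 < s'" using s' s t0 by auto
      \<comment> \<open>The weight \<open>c s'\<close> must be nonnegative for the minorant of
        \<open>w\<close> to remain a minorant after multiplication; this is where
        \<open>s' > \<beta>\<close> enters.\<close>
      have "\<beta> * (l + 2 - \<alpha>) \<le> \<beta> * 1"
        using l beta by (intro mult_left_mono) auto
      then have "0 \<le> c s'" unfolding c_def using pos' by auto
      moreover have "w \<tau> + \<xi> \<tau> \<bullet> (x s' - x \<tau>) \<le> w s'"
        using w_le_subgradient[OF pos'(1) pos(1)] by (simp add: inner_diff_right)
      ultimately have "c s' * (w \<tau> + \<xi> \<tau> \<bullet> (x s' - x \<tau>)) \<le> c s' * w s'"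
        by (intro mult_left_mono)
      then show ?thesis
        using m_ge_1[OF pos'(2)] unfolding q_def G_def E_eq power2_norm_eq_inner
        by (intro mult_left_mono) (auto simp: c_def z_def)
    qed
    ultimately show "\<exists>q D. (q has_real_derivative D) (at \<tau>) \<and>
        D \<le> - (\<beta> * \<tau> * (\<tau> - \<beta>) * (norm (\<xi> \<tau>))\<^sup>2) \<and> q \<tau> = G l \<tau> \<and> (\<forall>s'\<in>{s..<\<tau>}. q s' \<le> G l s')"
      by blast
  qed
qed

lemma xi_weighted_integrable:
  assumes "t0 < s"
  shows "(\<lambda>\<tau>. \<beta> * \<tau> * (\<tau> - \<beta>) * (norm (\<xi> \<tau>))\<^sup>2) integrable_on {s..t}"
  using assms
  by (intro set_lebesgue_integral_eq_integral(1) absolutely_integrable_continuous_mult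
      xi_sq_integrable continuous_intros)

lemma G_decay:
  assumes s: "t0 < s" "\<beta> < s" "s \<le> t" and l: "l \<in> {2..\<alpha> - 1}"
  shows "G l t + integral {s..t} (\<lambda>\<tau>. \<beta> * \<tau> * (\<tau> - \<beta>) * (norm (\<xi> \<tau>))\<^sup>2) \<le> G l s"
  using energy_decay[OF assms] by simp

lemma G_antimono:
  assumes s: "t0 < s" "\<beta> < s" "s \<le> t" and l: "l \<in> {2..\<alpha> - 1}"
  shows "G l t \<le> G l s"
proof -
  have "0 \<le> integral {s..t} (\<lambda>\<tau>. \<beta> * \<tau> * (\<tau> - \<beta>) * (norm (\<xi> \<tau>))\<^sup>2)"
    using s t0 beta by (intro integral_nonneg xi_weighted_integrable) auto
  then show ?thesis using G_decay[OF assms] by linarith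
qed

lemma E_le_G: "E l t \<le> G l t" if "t0 < t" "\<beta> < t" "l \<in> {2..\<alpha> - 1}"
  using mult_right_mono[OF m_ge_1[OF that(2)] E_nonneg[OF that]] by (simp add: G_def)

lemma G_nonneg: "0 \<le> G l t" if "t0 < t" "\<beta> < t" "l \<in> {2..\<alpha> - 1}"
  using E_le_G[OF that] E_nonneg[OF that] by linarith

section \<open>Asymptotics of the gap, the energy, the subgradients and the trajectory\<close>

lemma w_le:
  assumes s: "t0 < s" "\<beta> < s" "s \<le> t" and l: "l \<in> {2..\<alpha> - 1}"
  shows "w t \<le> 1 / t\<^sup>2 * G l s"
proof -
  have t: "t0 < t" "\<beta> < t" "0 < t" "0 < t - \<beta>" using s t0 by auto
  \<comment> \<open>The energy alone controls only \<open>t * (t - \<beta>) * w t\<close>. As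
    \<open>\<alpha> - 2 \<ge> 1\<close>, the factor \<open>m t\<close> supplies the missing
    \<open>t / (t - \<beta>)\<close> and upgrades this to \<open>t\<^sup>2 * w t\<close>.\<close>
  have "(t / (t - \<beta>)) powr 1 \<le> m t"
    unfolding m_def using t beta alpha by (intro powr_mono) auto
  then have "t / (t - \<beta>) \<le> m t" using t by simp
  moreover have tw: "0 \<le> t * (t - \<beta>) * w t" using t w_nonneg by simp
  ultimately have "t / (t - \<beta>) * (t * (t - \<beta>) * w t) \<le> m t * (t * (t - \<beta>) * w t)"
    by (intro mult_right_mono)
  also have "t * (t - \<beta>) * w t \<le> E l t"
    using E_ge[OF t(1,2) l] zero_le_power2[of "norm (l *\<^sub>R (x t - xs) + t *\<^sub>R v t)"] by linarith
  then have "m t * (t * (t - \<beta>) * w t) \<le> G l t"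
    unfolding G_def using m_ge_1[OF t(2)] by (intro mult_left_mono) auto
  also have "G l t \<le> G l s" by (rule G_antimono[OF assms])
  also have "t / (t - \<beta>) * (t * (t - \<beta>) * w t) = t\<^sup>2 * w t"
    using t by (simp add: power2_eq_square)
  finally show ?thesis using t by (simp add: le_divide_eq mult.commute)
qed

lemma m_tendsto: "(m \<longlongrightarrow> 1) at_top"
proof -
  have "((\<lambda>t. \<beta> / t) \<longlongrightarrow> 0) at_top"
    by (intro tendsto_divide_0[OF tendsto_const] filterlim_at_top_imp_at_infinity filterlim_ident)
  then have "((\<lambda>t. (1 / (1 - \<beta> / t)) powr (\<alpha> - 2)) \<longlongrightarrow> (1 / (1 - 0)) powr (\<alpha> - 2)) at_top"
    by (intro tendsto_intros) auto
  moreover have "\<forall>\<^sub>F t in at_top. (1 / (1 - \<beta> / t)) powr (\<alpha> - 2) = m t"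
    using eventually_gt_at_top[of 0] by eventually_elim (simp add: m_def divide_simps)
  ultimately show ?thesis by (simp add: filterlim_cong)
qed

text \<open>Beyond \<open>max t0 \<beta>\<close> the function \<open>G l\<close> is nonincreasing
  and nonnegative, hence convergent; division by \<open>m\<close> returns to the energy.\<close>

lemma E_converges:
  assumes l: "l \<in> {2..\<alpha> - 1}"
  shows "\<exists>L. (E l \<longlongrightarrow> L) at_top"
proof -
  define T where "T = max t0 \<beta>"
  define L where "L = Inf (G l ` {T<..})"
  have bdd: "bdd_below (G l ` {T<..})"
    using G_nonneg[OF _ _ l] by (auto simp: T_def intro!: bdd_belowI[of _ 0])
  have "(G l \<longlongrightarrow> L) at_top"
  proof (rule decreasing_tendsto)
    show "\<forall>\<^sub>F t in at_top. L \<le> G l t"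
      using eventually_gt_at_top[of T] by eventually_elim (auto simp: L_def intro!: cInf_lower bdd)
    fix z assume "L < z"
    then obtain s where s: "T < s" "G l s < z"
      unfolding L_def by (subst (asm) cInf_less_iff[OF _ bdd]) auto
    show "\<forall>\<^sub>F t in at_top. G l t < z"
      using eventually_ge_at_top[of s]
    proof eventually_elim
      case (elim t)
      then show ?case using G_antimono[of s t l] s l by (auto simp: T_def)
    qed
  qed
  then have "((\<lambda>t. G l t / m t) \<longlongrightarrow> L / 1) at_top"
    by (intro tendsto_divide m_tendsto) auto
  moreover have "\<forall>\<^sub>F t in at_top. G l t / m t = E l t"
    using eventually_gt_at_top[of \<beta>]
  proof eventually_elim
    case (elim t)
    then show ?case using m_ge_1[of t] by (simp add: G_def)
  qed
  ultimately have "(E l \<longlongrightarrow> L / 1) at_top" by (simp add: filterlim_cong)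
  then show ?thesis ..
qed

lemma weighted_xi_sq_integrable: "set_integrable lebesgue {t0..} (\<lambda>t. t\<^sup>2 * (norm (\<xi> t))\<^sup>2)"
proof -
  \<comment> \<open>Distance 1 from \<open>\<beta>\<close> ensures
    \<open>\<tau> \<le> (1 + \<beta>) * (\<tau> - \<beta>)\<close>, whence the constant
    \<open>(1 + \<beta>) / \<beta>\<close> when \<open>\<tau>\<^sup>2\<close> is replaced by the
    dissipation weight.\<close>
  define s where "s = max t0 \<beta> + 1"
  have s: "t0 < s" "\<beta> < s" "\<beta> + 1 \<le> s" "0 < s" using t0 by (auto simp: s_def)
  have two: "2 \<in> {2..\<alpha> - 1}" using alpha by simp
  have "(\<lambda>t. t\<^sup>2 * (norm (\<xi> t))\<^sup>2) integrable_on {s..}"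
  proof (rule integrable_on_atLeast_if_bounded_integrals)
    fix t assume "s \<le> t"
    show int: "(\<lambda>t. t\<^sup>2 * (norm (\<xi> t))\<^sup>2) integrable_on {s..t}"
      using s by (intro set_lebesgue_integral_eq_integral(1) absolutely_integrable_continuous_mult
          xi_sq_integrable continuous_intros)
    have "integral {s..t} (\<lambda>t. t\<^sup>2 * (norm (\<xi> t))\<^sup>2)
        \<le> integral {s..t} (\<lambda>\<tau>. (1 + \<beta>) / \<beta> * (\<beta> * \<tau> * (\<tau> - \<beta>) * (norm (\<xi> \<tau>))\<^sup>2))"
    proof (intro integral_le int integrable_on_mult_right xi_weighted_integrable s)
      fix \<tau> assume "\<tau> \<in> {s..t}"
      then have \<tau>: "\<beta> + 1 \<le> \<tau>" "0 < \<tau>" using s by auto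
      have "\<beta> * (\<beta> + 1) \<le> \<beta> * \<tau>" using \<tau> beta by (intro mult_left_mono) auto
      then have "\<tau> \<le> (1 + \<beta>) * (\<tau> - \<beta>)" by (simp add: algebra_simps)
      then have "\<tau> * \<tau> * (norm (\<xi> \<tau>))\<^sup>2 \<le> \<tau> * ((1 + \<beta>) * (\<tau> - \<beta>)) * (norm (\<xi> \<tau>))\<^sup>2"
        using \<tau> by (intro mult_right_mono mult_left_mono) auto
      also have "\<dots> = (1 + \<beta>) / \<beta> * (\<beta> * \<tau> * (\<tau> - \<beta>) * (norm (\<xi> \<tau>))\<^sup>2)"
        using beta by simp
      finally show "\<tau>\<^sup>2 * (norm (\<xi> \<tau>))\<^sup>2 \<le> (1 + \<beta>) / \<beta> * (\<beta> * \<tau> * (\<tau> - \<beta>) * (norm (\<xi> \<tau>))\<^sup>2)"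
        by (simp add: power2_eq_square)
    qed
    also have "\<dots> \<le> (1 + \<beta>) / \<beta> * G 2 s"
      unfolding integral_mult_right
      using G_decay[OF s(1,2) \<open>s \<le> t\<close> two] G_nonneg[of t 2] s \<open>s \<le> t\<close> two beta
      by (intro mult_left_mono) auto
    finally show "integral {s..t} (\<lambda>t. t\<^sup>2 * (norm (\<xi> t))\<^sup>2) \<le> (1 + \<beta>) / \<beta> * G 2 s" .
  qed simp
  then have tail: "(\<lambda>t. t\<^sup>2 * (norm (\<xi> t))\<^sup>2) absolutely_integrable_on {s..}"
    by (intro nonnegative_absolutely_integrable_1) auto
  \<comment> \<open>The decay estimate is available only beyond \<open>\<beta>\<close>; up to
    \<open>s\<close> the weight is bounded and \<open>L2\<close> suffices.\<close>
  have "(\<lambda>t. t\<^sup>2) ` {t0<..<s} \<subseteq> {0..s\<^sup>2}"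
    using t0 by (auto intro: power_mono)
  then have "bounded ((\<lambda>t. t\<^sup>2) ` {t0<..<s})"
    by (rule bounded_subset[rotated]) simp
  then have "(\<lambda>t. t\<^sup>2 * (norm (\<xi> t))\<^sup>2) absolutely_integrable_on {t0<..<s}"
    by (intro absolutely_integrable_bounded_measurable_product_real
        L2_on_norm_absolutely_integrable(1) L2 s continuous_imp_measurable_on_sets_lebesgue
        continuous_intros) auto
  from set_integrable_Un[OF this tail]
  have "(\<lambda>t. t\<^sup>2 * (norm (\<xi> t))\<^sup>2) absolutely_integrable_on ({t0<..<s} \<union> {s..})" by simp
  moreover have "{t0<..<s} \<union> {s..} = {t0<..}" using s by auto
  \<comment> \<open>\<open>L2\<close> speaks of open intervals, so \<open>t0\<close> itself is added
    as a null set.\<close>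
  moreover have "negligible {t \<in> {t0..} - {t0<..}. t\<^sup>2 * (norm (\<xi> t))\<^sup>2 \<noteq> 0}"
    by (rule negligible_subset[of "{t0}"]) auto
  moreover have "negligible {t \<in> {t0<..} - {t0..}. t\<^sup>2 * (norm (\<xi> t))\<^sup>2 \<noteq> 0}"
    by (rule negligible_subset[of "{}"]) auto
  ultimately show ?thesis
    using absolutely_integrable_spike_set_eq[of "{t0..}" "{t0<..}" "\<lambda>t. t\<^sup>2 * (norm (\<xi> t))\<^sup>2"]
    by simp
qed

text \<open>Expanding the square of \<open>t * norm (\<xi> t) - inverse t\<close> dominates the norm
  by the weighted square plus \<open>1 / t\<^sup>2\<close>, and the latter is integrable up to
  infinity because \<open>t0 > 0\<close>.\<close>

lemma xi_integrable_atLeast: "set_integrable lebesgue {t0..} (\<lambda>t. norm (\<xi> t))"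
proof (rule measurable_bounded_by_integrable_imp_absolutely_integrable)
  have "(\<lambda>t. t\<^sup>2 * (norm (\<xi> t))\<^sup>2) \<in> borel_measurable (lebesgue_on {t0..})"
    using weighted_xi_sq_integrable by (simp add: absolutely_integrable_measurable)
  moreover have "(\<lambda>t. t) \<in> borel_measurable (lebesgue_on {t0..})"
    by (intro continuous_imp_measurable_on_sets_lebesgue continuous_intros) auto
  ultimately have "(\<lambda>t. sqrt (t\<^sup>2 * (norm (\<xi> t))\<^sup>2) / t) \<in> borel_measurable (lebesgue_on {t0..})"
    by measurable
  then show "(\<lambda>t. norm (\<xi> t)) \<in> borel_measurable (lebesgue_on {t0..})"
    by (rule measurable_cong[THEN iffD1, rotated]) (use t0 in \<open>auto simp: real_sqrt_mult\<close>)
  show "(\<lambda>t. t\<^sup>2 * (norm (\<xi> t))\<^sup>2 + inverse (t ^ 2)) integrable_on {t0..}"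
    using set_lebesgue_integral_eq_integral(1)[OF weighted_xi_sq_integrable]
      has_integral_inverse_power_to_inf[of 2 t0] t0
    by (intro integrable_add) (auto simp: has_integral_iff inverse_eq_divide)
  fix t assume "t \<in> {t0..}"
  then have "0 < t" using t0 by simp
  have "0 \<le> (t * norm (\<xi> t) - inverse t)\<^sup>2" by simp
  also have "\<dots> = t\<^sup>2 * (norm (\<xi> t))\<^sup>2 + inverse (t ^ 2) - 2 * norm (\<xi> t)"
    using \<open>0 < t\<close> by (simp add: power2_eq_square algebra_simps)
  finally show "norm (norm (\<xi> t)) \<le> t\<^sup>2 * (norm (\<xi> t))\<^sup>2 + inverse (t ^ 2)"
    unfolding real_norm_def abs_norm_cancel using norm_ge_zero[of "\<xi> t"] by linarith
qed auto

text \<open>Half of the squared norm is at most \<open>E 2 t\<close>, and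
  \<open>E 2 t \<le> G 2 t \<le> G 2 s\<close>.\<close>

lemma x_v_bound:
  obtains B s where "t0 < s" "\<beta> < s" "0 \<le> B"
    "\<And>t. s \<le> t \<Longrightarrow> norm (2 *\<^sub>R (x t - xs) + t *\<^sub>R v t) \<le> B"
proof -
  define s where "s = max t0 \<beta> + 1"
  have s: "t0 < s" "\<beta> < s" by (auto simp: s_def)
  have two: "2 \<in> {2..\<alpha> - 1}" using alpha by simp
  have "norm (2 *\<^sub>R (x t - xs) + t *\<^sub>R v t) \<le> sqrt (2 * G 2 s)" if "s \<le> t" for t
  proof (rule real_le_rsqrt)
    have t: "t0 < t" "\<beta> < t" "0 < t" using s that t0 by auto
    have "0 \<le> t * (t - \<beta>) * w t" using t w_nonneg[of t] by simp
    then show "(norm (2 *\<^sub>R (x t - xs) + t *\<^sub>R v t))\<^sup>2 \<le> 2 * G 2 s"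
      using E_ge[OF t(1,2) two] E_le_G[OF t(1,2) two] G_antimono[OF s that two] by linarith
  qed
  then show ?thesis using that[of s "sqrt (2 * G 2 s)"] s G_nonneg[OF s two] by simp
qed

text \<open>
  The derivative \<open>t * (2 * (x t - xs) + t * v t) - \<beta> * t\<^sup>2 * \<xi> t\<close> of \<open>t\<^sup>2 * (x t - xs)\<close> is controlled by
  the energy with \<open>l = 2\<close> and the integrability of \<open>\<xi>\<close>; this covers \<open>\<alpha> = 3\<close>, where the last term of
  the energy vanishes.
\<close>

lemma bounded_trajectory: "bounded (x ` {t0..})"
proof -
  obtain B s where s: "t0 < s" "\<beta> < s" and B: "0 \<le> B"
    "\<And>t. s \<le> t \<Longrightarrow> norm (2 *\<^sub>R (x t - xs) + t *\<^sub>R v t) \<le> B"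
    by (rule x_v_bound) blast
  obtain N where N: "negligible N"
    "\<And>t. \<lbrakk>t0 < t; t \<notin> N\<rbrakk> \<Longrightarrow> (x has_vector_derivative v t - \<beta> *\<^sub>R \<xi> t) (at t)"
    using derivatives_obtain by metis
  define J where "J = integral {t0..} (\<lambda>t. norm (\<xi> t))"
  have "norm (x t - xs) \<le> B + \<beta> * J + norm (x s - xs)" if t: "s \<le> t" for t
  proof -
    have pos: "0 < s" "0 < t" using s t0 t by auto
    define g where "g = (\<lambda>t. t\<^sup>2 *\<^sub>R (x t - xs))"
    \<comment> \<open>The weights \<open>\<tau>\<close> and \<open>\<tau>\<^sup>2\<close> are frozen
      at their largest values, so that division by \<open>t\<^sup>2\<close> at the end leaves a
      bound independent of \<open>t\<close>.\<close>
    define k where "k = (\<lambda>\<tau>. t * B + \<beta> * t\<^sup>2 * norm (\<xi> \<tau>))"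
    have xi_int: "(\<lambda>\<tau>. norm (\<xi> \<tau>)) integrable_on {s..t}"
      using set_lebesgue_integral_eq_integral(1)[OF xi_integrable[OF s(1)]] .
    have "norm (g t - g s) \<le> integral {s..t} k"
    proof (rule norm_abs_continuous_on_increment_le_integral[OF t _ N(1)])
      show "abs_continuous_on {s..t} g"
        unfolding g_def power2_eq_square
        by (intro abs_continuous_on_scaleR abs_continuous_on_mult abs_continuous_on_diff
            abs_continuous_x[OF s(1)] abs_continuous_on_const abs_continuous_on_ident) auto
      show "k absolutely_integrable_on {s..t}"
        unfolding k_def
        by (intro set_integral_add(1) set_integrable_mult_right xi_integrable[OF s(1)]) auto
      fix \<tau> assume \<tau>: "s < \<tau>" "\<tau> < t" "\<tau> \<notin> N"
      have \<tau>_pos: "0 < \<tau>" using \<tau> pos by simp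
      have x': "((\<lambda>t. x t - xs) has_vector_derivative v \<tau> - \<beta> *\<^sub>R \<xi> \<tau>) (at \<tau>)"
        using has_vector_derivative_diff[OF N(2) has_vector_derivative_const[of xs]] s \<tau> by simp
      have "(g has_vector_derivative \<tau>\<^sup>2 *\<^sub>R (v \<tau> - \<beta> *\<^sub>R \<xi> \<tau>) + (2 * \<tau>) *\<^sub>R (x \<tau> - xs)) (at \<tau>)"
        unfolding g_def
        by (intro has_vector_derivative_scaleR x') (auto intro!: derivative_eq_intros)
      moreover have "\<tau>\<^sup>2 *\<^sub>R (v \<tau> - \<beta> *\<^sub>R \<xi> \<tau>) + (2 * \<tau>) *\<^sub>R (x \<tau> - xs)
          = \<tau> *\<^sub>R (2 *\<^sub>R (x \<tau> - xs) + \<tau> *\<^sub>R v \<tau>) - (\<beta> * \<tau>\<^sup>2) *\<^sub>R \<xi> \<tau>"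
        by (simp add: algebra_simps power2_eq_square)
      moreover have "norm (\<tau> *\<^sub>R (2 *\<^sub>R (x \<tau> - xs) + \<tau> *\<^sub>R v \<tau>) - (\<beta> * \<tau>\<^sup>2) *\<^sub>R \<xi> \<tau>) \<le> k \<tau>"
      proof -
        have "norm (\<tau> *\<^sub>R (2 *\<^sub>R (x \<tau> - xs) + \<tau> *\<^sub>R v \<tau>) - (\<beta> * \<tau>\<^sup>2) *\<^sub>R \<xi> \<tau>)
            \<le> \<tau> * norm (2 *\<^sub>R (x \<tau> - xs) + \<tau> *\<^sub>R v \<tau>) + \<beta> * \<tau>\<^sup>2 * norm (\<xi> \<tau>)"
          using norm_triangle_ineq4[of "\<tau> *\<^sub>R (2 *\<^sub>R (x \<tau> - xs) + \<tau> *\<^sub>R v \<tau>)" "(\<beta> * \<tau>\<^sup>2) *\<^sub>R \<xi> \<tau>"]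
            \<tau>_pos beta by simp
        also have "\<dots> \<le> k \<tau>"
          unfolding k_def using B \<tau> \<tau>_pos beta
          by (intro add_mono mult_mono power_mono) auto
        finally show ?thesis .
      qed
      ultimately show "\<exists>D. (g has_vector_derivative D) (at \<tau>) \<and> norm D \<le> k \<tau>" by metis
    qed
    also have "integral {s..t} k = (t - s) * (t * B) + \<beta> * t\<^sup>2 * integral {s..t} (\<lambda>\<tau>. norm (\<xi> \<tau>))"
      unfolding k_def using xi_int t by (subst integral_add) (auto intro: integrable_on_mult_right)
    also have "\<dots> \<le> t * (t * B) + \<beta> * t\<^sup>2 * J"
    proof (intro add_mono mult_mono mult_left_mono)
      show "integral {s..t} (\<lambda>\<tau>. norm (\<xi> \<tau>)) \<le> J"
        unfolding J_def using xi_int s set_lebesgue_integral_eq_integral(1)[OF xi_integrable_atLeast]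
        by (intro integral_subset_le) auto
      show "0 \<le> integral {s..t} (\<lambda>\<tau>. norm (\<xi> \<tau>))"
        using xi_int by (intro integral_nonneg) auto
    qed (use pos B beta in auto)
    finally have "norm (g t - g s) \<le> t\<^sup>2 * (B + \<beta> * J)"
      by (simp add: power2_eq_square algebra_simps)
    moreover have "norm (g t) \<le> norm (g t - g s) + norm (g s)"
      using norm_triangle_ineq[of "g t - g s" "g s"] by simp
    moreover have "norm (g s) \<le> t\<^sup>2 * norm (x s - xs)"
      using pos t by (auto simp: g_def intro!: mult_right_mono power_mono)
    ultimately have "t\<^sup>2 * norm (x t - xs) \<le> t\<^sup>2 * (B + \<beta> * J + norm (x s - xs))"
      by (simp add: g_def distrib_left)
    then show ?thesis using pos by simp
  qed
  then have "norm (x t) \<le> B + \<beta> * J + norm (x s - xs) + norm xs" if "s \<le> t" for t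
    using that norm_triangle_ineq[of "x t - xs" xs] by fastforce
  then have "bounded (x ` {s..})" by (auto intro!: boundedI)
  moreover have "bounded (x ` {t0..s})"
    by (intro compact_imp_bounded compact_continuous_image continuous_x) auto
  moreover have "x ` {t0..} = x ` {t0..s} \<union> x ` {s..}"
    using s by (auto simp flip: image_Un)
  ultimately show ?thesis by simp
qed

text \<open>Once \<open>x\<close> is bounded, \<open>t *\<^sub>R v t\<close> is a difference of two
  bounded quantities.\<close>

lemma v_bound: "\<exists>C T. \<forall>t\<ge>T. norm (v t) \<le> C / t"
proof -
  obtain B s where s: "t0 < s" "\<beta> < s" and B: "0 \<le> B"
    "\<And>t. s \<le> t \<Longrightarrow> norm (2 *\<^sub>R (x t - xs) + t *\<^sub>R v t) \<le> B"
    by (rule x_v_bound) blast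
  obtain A where A: "\<And>t. t0 \<le> t \<Longrightarrow> norm (x t) \<le> A"
    using bounded_trajectory by (auto simp: bounded_iff)
  have "norm (v t) \<le> (B + 2 * (A + norm xs)) / t" if "s \<le> t" for t
  proof -
    have "0 < t" "t0 \<le> t" using that s t0 by auto
    have "t *\<^sub>R v t = (2 *\<^sub>R (x t - xs) + t *\<^sub>R v t) - 2 *\<^sub>R (x t - xs)" by simp
    then have "norm (t *\<^sub>R v t) \<le> norm (2 *\<^sub>R (x t - xs) + t *\<^sub>R v t) + norm (2 *\<^sub>R (x t - xs))"
      by (metis norm_triangle_ineq4)
    also have "\<dots> \<le> B + 2 * (A + norm xs)"
      using B(2)[OF that] A[OF \<open>t0 \<le> t\<close>] norm_triangle_ineq4[of "x t" xs] by simp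
    finally show ?thesis using \<open>0 < t\<close> by (simp add: le_divide_eq mult.commute)
  qed
  then show ?thesis by blast
qed

end

theorem theorem4p9:
  fixes \<phi> :: "'h::{real_inner, complete_space} \<Rightarrow> ereal"
    and \<alpha> \<beta> t0 t1 l :: real
    and x y \<xi> :: "real \<Rightarrow> 'h"
    and x0 y0 xs :: 'h
  assumes "proper_function \<phi>" and "lower_semicontinuous \<phi>" and "convex_function \<phi>"
    and "argmin_set \<phi> \<noteq> {}"
    and "\<alpha> \<ge> 3" and "\<beta> > 0" and "t0 > 0"
    and "global_strong_solution \<phi> \<alpha> \<beta> t0 x y"
    and "x t0 = x0" and "y t0 = y0" and "x0 \<in> effective_domain \<phi>"
    and "\<forall>t>t0. \<xi> t \<in> subdifferential \<phi> (x t)"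
    and "AE t in lebesgue. t > t0 \<longrightarrow>
           vector_derivative x (at t) + \<beta> *\<^sub>R \<xi> t - (1 / \<beta> - \<alpha> / t) *\<^sub>R x t + (1 / \<beta>) *\<^sub>R y t = 0"
    and "\<forall>T>t0. L2_on t0 T \<xi>"
    and "xs \<in> argmin_set \<phi>" and "l \<in> {2..\<alpha> - 1}" and "t1 = max t0 \<beta>"
  shows "(\<exists>L. (energy \<phi> \<alpha> \<beta> l xs x y \<longlongrightarrow> L) at_top)
    \<and> ((\<forall>s t. t1 < s \<and> s \<le> t \<longrightarrow>
            \<phi> (x t) - min_value \<phi>
              \<le> ereal (1 / t\<^sup>2 * (s / (s - \<beta>)) powr (\<alpha> - 2) * energy \<phi> \<alpha> \<beta> l xs x y s))
        \<and> (\<lambda>t. real_of_ereal (\<phi> (x t) - min_value \<phi>)) \<in> O[at_top](\<lambda>t. 1 / t\<^sup>2))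
    \<and> bounded (x ` {t0..})
    \<and> (set_integrable lebesgue {t0..} (\<lambda>t. t\<^sup>2 * (norm (\<xi> t))\<^sup>2)
        \<and> set_integrable lebesgue {t0..} (\<lambda>t. norm (\<xi> t)))
    \<and> (\<exists>C T. AE t in lebesgue. t \<ge> T \<longrightarrow>
          norm (vector_derivative x (at t) + \<beta> *\<^sub>R \<xi> t) \<le> C / t)"
proof -
  interpret din_avd_solution \<phi> \<alpha> \<beta> t0 x y \<xi> xs
    using assms by unfold_locales auto
  note l = \<open>l \<in> {2..\<alpha> - 1}\<close>
  have E_energy: "E l = energy \<phi> \<alpha> \<beta> l xs x y" by (simp add: E_def[abs_def])
  have "\<phi> (x t) - min_value \<phi>
      \<le> ereal (1 / t\<^sup>2 * (s / (s - \<beta>)) powr (\<alpha> - 2) * energy \<phi> \<alpha> \<beta> l xs x y s)"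
    if "t1 < s" "s \<le> t" for s t
    using w_le[of s t l] phi_diff_eq[of t] that l assms(17) by (simp add: G_def m_def E_def mult.assoc)
  moreover have "(\<lambda>t. real_of_ereal (\<phi> (x t) - min_value \<phi>)) \<in> O[at_top](\<lambda>t. 1 / t\<^sup>2)"
  proof (rule bigoI)
    show "\<forall>\<^sub>F t in at_top. norm (real_of_ereal (\<phi> (x t) - min_value \<phi>)) \<le> G l (t1 + 1) * norm (1 / t\<^sup>2)"
      using eventually_ge_at_top[of "t1 + 1"]
    proof eventually_elim
      case (elim t)
      then show ?case
        using w_le[of "t1 + 1" t l] w_nonneg[of t] l assms(17) unfolding w_def[symmetric]
        by (simp add: mult.commute)
    qed
  qed
  moreover have "\<exists>C T. AE t in lebesgue. t \<ge> T \<longrightarrow>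
      norm (vector_derivative x (at t) + \<beta> *\<^sub>R \<xi> t) \<le> C / t"
  proof -
    obtain C T where "\<And>t. T \<le> t \<Longrightarrow> norm (v t) \<le> C / t"
      using v_bound by blast
    \<comment> \<open>The bound \<open>t0 + 1\<close> guarantees \<open>t > t0\<close>, where the
      identity with \<open>v t\<close> holds almost everywhere.\<close>
    then have "AE t in lebesgue. t \<ge> max T (t0 + 1) \<longrightarrow>
        norm (vector_derivative x (at t) + \<beta> *\<^sub>R \<xi> t) \<le> C / t"
      using AE_derivatives by (auto elim!: eventually_mono)
    then show ?thesis by blast
  qed
  ultimately show ?thesis
    using E_converges[OF l, unfolded E_energy] bounded_trajectory weighted_xi_sq_integrable
      xi_integrable_atLeast by blast
qed

end
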